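(* The functors $$Coz:\mathbf{CHaus}^{\mathrm{op}}\to\mathbf{AlexAlg}_c\quad\text{and}\quad C:\mathbf{AlexAlg}_c\to\mathbf{CHaus}^{\mathrm{op}}$$ (defined in the context) yield a duality between the category $\mathbf{CHaus}$ of compact Hausdorff spaces and the full subcategory $\mathbf{AlexAlg}_c$ of the category of Alexandrov algebras on the countably compact ones. In fact, the functor $C:\mathbf{AlexAlg}_c\to\mathbf{CHaus}^{\mathrm{op}}$ is naturally isomorphic, under the identification $\mathbf{AlexAlg}_c=\mathbf{CHDLat}$, to the functor $Max:\mathbf{CHDLat}\to\mathbf{CHaus}^{\mathrm{op}}$.
   Context: $\mathbf{CHaus}$ is the category of compact Hausdorff spaces and continuous maps. All distributive lattices are bounded. A distributive lattice $D$ is normal if for all $a,b$ with $a\vee b=1$ there are $c,d$ with $c\vee a=b\vee d=1$ and $c\wedge d=0$; it is conjunctive if for all $a,b\in D$: if every $c\in D$ with $a\vee c=1$ satisfies $b\vee c=1$, then $a\le b$. An Alexandrov algebra is a normal distributive lattice $D$ in which countable joins exist and distribute over finite meets, and such that for every $a\in D$ there are sequences $(b_n)_{n\in\mathbb N}$, $(c_n)_{n\in\mathbb N}$ in $D$ with $\bigvee_n c_n=a$, and $b_n\wedge c_n=0$, $b_n\vee a=1$ for all $n$. $\mathbf{AlexAlg}$ is the category of Alexandrov algebras and distributive lattice homomorphisms preserving countable joins. An Alexandrov algebra $D$ is countably compact if every countable family $(c_n)_{n\in\mathbb N}$ with $\bigvee_n c_n=1$ has a finite subfamily with join $1$; $\mathbf{AlexAlg}_c$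 is the full subcategory of $\mathbf{AlexAlg}$ on these. $Coz(X)$ is the lattice of open sets of $X$ of the form $f^{-1}(\mathbb R\setminus\{0\})$ with $f:X\to\mathbb R$ continuous; $Coz$ sends a continuous $f:X\to Y$ to $f^{-1}:Coz(Y)\to Coz(X)$. For an Alexandrov algebra $D$, the countable topology $C_D$ on $D$ is the Grothendieck topology whose covering sieves on $d$ are those containing a countable family with join $d$. A $C_D$-prime filter is a filter $F\subseteq D$ such that whenever a countable family of elements of $D$ (possibly empty) has join in $F$, some member lies in $F$. $X_{(D,C_D)}$ is the space of $C_D$-prime filters with basic open sets $\{F\mid d\in F\}$, $d\in D$. The functor $C$ sends $D$ to $X_{(D,C_D)}$ and $f:D\to D'$ to the continuous map $X_{(D',C_{D'})}\to X_{(D,C_D)}$, $F\mapsto f^{-1}(F)$. $Max(D)$ is the set of maximal ideals of $D$ with basic open sets $\{M\mid d\notin M\}$, $d\in D$. A lattice homomorphism $f:D\to D'$ is maximal if $f^{-1}$ sends maximal ideals of $D'$ to maximal ideals of $D$, giving a continuous map $Max(f):Max(D')\to Max(D)$. $\mathbf{CHDLat}$ is the category whose objects are the conjunctive distributive lattices isomorphic to $Coz(X)$ for some compact Hausdorff space $X$ and whose arrows are the maximal homomorphisms between them; it coincides with the category $\mathbf{AlexAlg}_c$. The functor $Max$ sends $D$ to $Max(D)$ and $f$ to $Max(f)$. *)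

theory Defs
  imports "HOL-Analysis.Analysis" "HOL-Algebra.Lattice"
begin

section \<open>Categories, functors, natural isomorphisms\<close>

record ('o, 'm) cat =
  Obj :: "'o set"
  Arr :: "'m set"
  Dom :: "'m \<Rightarrow> 'o"
  Cod :: "'m \<Rightarrow> 'o"
  Ide :: "'o \<Rightarrow> 'm"
  Cmp :: "'m \<Rightarrow> 'm \<Rightarrow> 'm"  \<comment> \<open>\<open>Cmp A g f\<close> is \<open>g\<close> after \<open>f\<close>\<close>

definition category :: "('o, 'm) cat \<Rightarrow> bool" where
  "category A \<longleftrightarrow>
     (\<forall>f\<in>Arr A. Dom A f \<in> Obj A \<and> Cod A f \<in> Obj A) \<and>
     (\<forall>X\<in>Obj A. Ide A X \<in> Arr A \<and> Dom A (Ide A X) = X \<and> Cod A (Ide A X) = X) \<and>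
     (\<forall>f\<in>Arr A. \<forall>g\<in>Arr A. Cod A f = Dom A g \<longrightarrow>
        Cmp A g f \<in> Arr A \<and> Dom A (Cmp A g f) = Dom A f \<and> Cod A (Cmp A g f) = Cod A g) \<and>
     (\<forall>f\<in>Arr A. Cmp A f (Ide A (Dom A f)) = f \<and> Cmp A (Ide A (Cod A f)) f = f) \<and>
     (\<forall>f\<in>Arr A. \<forall>g\<in>Arr A. \<forall>h\<in>Arr A. Cod A f = Dom A g \<longrightarrow> Cod A g = Dom A h \<longrightarrow>
        Cmp A h (Cmp A g f) = Cmp A (Cmp A h g) f)"

definition opposite :: "('o, 'm) cat \<Rightarrow> ('o, 'm) cat" where
  "opposite A = \<lparr>Obj = Obj A, Arr = Arr A, Dom = Cod A, Cod = Dom A, Ide = Ide A,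
                 Cmp = (\<lambda>g f. Cmp A f g)\<rparr>"

definition full_subcategory :: "('o, 'm) cat \<Rightarrow> ('o \<Rightarrow> bool) \<Rightarrow> ('o, 'm) cat" where
  "full_subcategory A P =
     A\<lparr>Obj := {X \<in> Obj A. P X}, Arr := {f \<in> Arr A. P (Dom A f) \<and> P (Cod A f)}\<rparr>"

definition iso_arrow :: "('o, 'm) cat \<Rightarrow> 'm \<Rightarrow> bool" where
  "iso_arrow A f \<longleftrightarrow> f \<in> Arr A \<and>
     (\<exists>g\<in>Arr A. Dom A g = Cod A f \<and> Cod A g = Dom A f \<and>
        Cmp A g f = Ide A (Dom A f) \<and> Cmp A f g = Ide A (Cod A f))"

record ('o1, 'm1, 'o2, 'm2) functor_data =
  fobj :: "'o1 \<Rightarrow> 'o2"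
  farr :: "'m1 \<Rightarrow> 'm2"

definition is_functor ::
    "('o1, 'm1) cat \<Rightarrow> ('o2, 'm2) cat \<Rightarrow> ('o1, 'm1, 'o2, 'm2) functor_data \<Rightarrow> bool" where
  "is_functor A B F \<longleftrightarrow> category A \<and> category B \<and>
     (\<forall>X\<in>Obj A. fobj F X \<in> Obj B) \<and>
     (\<forall>f\<in>Arr A. farr F f \<in> Arr B \<and> Dom B (farr F f) = fobj F (Dom A f) \<and>
                Cod B (farr F f) = fobj F (Cod A f)) \<and>
     (\<forall>X\<in>Obj A. farr F (Ide A X) = Ide B (fobj F X)) \<and>
     (\<forall>f\<in>Arr A. \<forall>g\<in>Arr A. Cod A f = Dom A g \<longrightarrow>
        farr F (Cmp A g f) = Cmp B (farr F g) (farr F f))"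

definition functor_comp ::
    "('o2, 'm2, 'o3, 'm3) functor_data \<Rightarrow> ('o1, 'm1, 'o2, 'm2) functor_data
      \<Rightarrow> ('o1, 'm1, 'o3, 'm3) functor_data" where
  "functor_comp G F = \<lparr>fobj = fobj G \<circ> fobj F, farr = farr G \<circ> farr F\<rparr>"

definition natural_iso ::
    "('o1, 'm1) cat \<Rightarrow> ('o2, 'm2) cat \<Rightarrow> ('o1, 'm1, 'o2, 'm2) functor_data
      \<Rightarrow> ('o1, 'm1, 'o2, 'm2) functor_data \<Rightarrow> ('o1 \<Rightarrow> 'm2) \<Rightarrow> bool" where
  "natural_iso A B F G \<eta> \<longleftrightarrow> is_functor A B F \<and> is_functor A B G \<and>
     (\<forall>X\<in>Obj A. iso_arrow B (\<eta> X) \<and> Dom B (\<eta> X) = fobj F X \<and> Cod B (\<eta> X) = fobj G X) \<and>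
     (\<forall>f\<in>Arr A. Cmp B (farr G f) (\<eta> (Dom A f)) = Cmp B (\<eta> (Cod A f)) (farr F f))"

definition naturally_isomorphic ::
    "('o1, 'm1) cat \<Rightarrow> ('o2, 'm2) cat \<Rightarrow> ('o1, 'm1, 'o2, 'm2) functor_data
      \<Rightarrow> ('o1, 'm1, 'o2, 'm2) functor_data \<Rightarrow> bool" where
  "naturally_isomorphic A B F G \<longleftrightarrow> (\<exists>\<eta>. natural_iso A B F G \<eta>)"


section \<open>Concrete categories\<close>

text \<open>An arrow records its source and target together with a map that is \<^const>\<open>undefined\<close>
  outside the carrier of the source, so that equal arrows are equal as elements of the type.\<close>

datatype ('o, 'p) arrow = Arrow (src: 'o) (mapping: "'p \<Rightarrow> 'p") (tgt: 'o)

definition concrete_category ::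
    "('o \<Rightarrow> 'p set) \<Rightarrow> 'o set \<Rightarrow> ('o \<Rightarrow> 'o \<Rightarrow> ('p \<Rightarrow> 'p) \<Rightarrow> bool) \<Rightarrow> ('o, ('o, 'p) arrow) cat" where
  "concrete_category U Os H =
     \<lparr>Obj = Os,
      Arr = {Arrow X f Y | X f Y. X \<in> Os \<and> Y \<in> Os \<and> f \<in> extensional (U X) \<and> H X Y f},
      Dom = src,
      Cod = tgt,
      Ide = (\<lambda>X. Arrow X (\<lambda>x\<in>U X. x) X),
      Cmp = (\<lambda>g f. Arrow (src f) (compose (U (src f)) (mapping g) (mapping f)) (tgt g))\<rparr>"


section \<open>Distributive lattices\<close>

definition distributive_lattice :: "'d gorder \<Rightarrow> bool" where
  "distributive_lattice D \<longleftrightarrow> bounded_lattice D \<and>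
     (\<forall>a\<in>carrier D. \<forall>b\<in>carrier D. \<forall>c\<in>carrier D.
        a \<sqinter>\<^bsub>D\<^esub> (b \<squnion>\<^bsub>D\<^esub> c) = (a \<sqinter>\<^bsub>D\<^esub> b) \<squnion>\<^bsub>D\<^esub> (a \<sqinter>\<^bsub>D\<^esub> c))"

definition normal_lattice :: "'d gorder \<Rightarrow> bool" where
  "normal_lattice D \<longleftrightarrow>
     (\<forall>a\<in>carrier D. \<forall>b\<in>carrier D. a \<squnion>\<^bsub>D\<^esub> b = \<top>\<^bsub>D\<^esub> \<longrightarrow>
        (\<exists>c\<in>carrier D. \<exists>d\<in>carrier D.
           c \<squnion>\<^bsub>D\<^esub> a = \<top>\<^bsub>D\<^esub> \<and> b \<squnion>\<^bsub>D\<^esub> d = \<top>\<^bsub>D\<^esub> \<and> c \<sqinter>\<^bsub>D\<^esub> d = \<bottom>\<^bsub>D\<^esub>))"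

definition conjunctive_lattice :: "'d gorder \<Rightarrow> bool" where
  "conjunctive_lattice D \<longleftrightarrow>
     (\<forall>a\<in>carrier D. \<forall>b\<in>carrier D.
        (\<forall>c\<in>carrier D. a \<squnion>\<^bsub>D\<^esub> c = \<top>\<^bsub>D\<^esub> \<longrightarrow> b \<squnion>\<^bsub>D\<^esub> c = \<top>\<^bsub>D\<^esub>) \<longrightarrow> a \<sqsubseteq>\<^bsub>D\<^esub> b)"

definition lattice_hom :: "'d gorder \<Rightarrow> 'e gorder \<Rightarrow> ('d \<Rightarrow> 'e) \<Rightarrow> bool" where
  "lattice_hom D E f \<longleftrightarrow> f \<in> carrier D \<rightarrow> carrier E \<and> f \<bottom>\<^bsub>D\<^esub> = \<bottom>\<^bsub>E\<^esub> \<and> f \<top>\<^bsub>D\<^esub> = \<top>\<^bsub>E\<^esub> \<and>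
     (\<forall>a\<in>carrier D. \<forall>b\<in>carrier D.
        f (a \<sqinter>\<^bsub>D\<^esub> b) = f a \<sqinter>\<^bsub>E\<^esub> f b \<and> f (a \<squnion>\<^bsub>D\<^esub> b) = f a \<squnion>\<^bsub>E\<^esub> f b)"

definition isomorphic_lattices :: "'d gorder \<Rightarrow> 'e gorder \<Rightarrow> bool" where
  "isomorphic_lattices D E \<longleftrightarrow> (\<exists>f. lattice_hom D E f \<and> bij_betw f (carrier D) (carrier E))"

definition lattice_filter :: "'d gorder \<Rightarrow> 'd set \<Rightarrow> bool" where
  "lattice_filter D F \<longleftrightarrow> F \<subseteq> carrier D \<and> \<top>\<^bsub>D\<^esub> \<in> F \<and>
     (\<forall>a\<in>F. \<forall>b\<in>carrier D. a \<sqsubseteq>\<^bsub>D\<^esub> b \<longrightarrow> b \<in> F) \<and> (\<forall>a\<in>F. \<forall>b\<in>F. a \<sqinter>\<^bsub>D\<^esub> b \<in> F)"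

definition lattice_ideal :: "'d gorder \<Rightarrow> 'd set \<Rightarrow> bool" where
  "lattice_ideal D I \<longleftrightarrow> I \<subseteq> carrier D \<and> \<bottom>\<^bsub>D\<^esub> \<in> I \<and>
     (\<forall>a\<in>I. \<forall>b\<in>carrier D. b \<sqsubseteq>\<^bsub>D\<^esub> a \<longrightarrow> b \<in> I) \<and> (\<forall>a\<in>I. \<forall>b\<in>I. a \<squnion>\<^bsub>D\<^esub> b \<in> I)"

definition maximal_lattice_ideal :: "'d gorder \<Rightarrow> 'd set \<Rightarrow> bool" where
  "maximal_lattice_ideal D M \<longleftrightarrow> lattice_ideal D M \<and> M \<noteq> carrier D \<and>
     (\<forall>I. lattice_ideal D I \<and> M \<subseteq> I \<and> I \<noteq> carrier D \<longrightarrow> I = M)"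

definition maximal_hom :: "'d gorder \<Rightarrow> 'e gorder \<Rightarrow> ('d \<Rightarrow> 'e) \<Rightarrow> bool" where
  "maximal_hom D E f \<longleftrightarrow> lattice_hom D E f \<and>
     (\<forall>M. maximal_lattice_ideal E M \<longrightarrow> maximal_lattice_ideal D (f -` M \<inter> carrier D))"


section \<open>Alexandrov algebras\<close>

definition alexandrov_algebra :: "'d gorder \<Rightarrow> bool" where
  "alexandrov_algebra D \<longleftrightarrow> distributive_lattice D \<and> normal_lattice D \<and>
     (\<forall>S. countable S \<and> S \<subseteq> carrier D \<longrightarrow>
        (\<exists>s. is_lub D s S) \<and>
        (\<forall>a\<in>carrier D. a \<sqinter>\<^bsub>D\<^esub> (\<Squnion>\<^bsub>D\<^esub>S) = \<Squnion>\<^bsub>D\<^esub>((\<lambda>s. a \<sqinter>\<^bsub>D\<^esub> s) ` S))) \<and>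
     (\<forall>a\<in>carrier D. \<exists>b c :: nat \<Rightarrow> 'd. range b \<subseteq> carrier D \<and> range c \<subseteq> carrier D \<and>
        \<Squnion>\<^bsub>D\<^esub>(range c) = a \<and>
        (\<forall>n. b n \<sqinter>\<^bsub>D\<^esub> c n = \<bottom>\<^bsub>D\<^esub> \<and> b n \<squnion>\<^bsub>D\<^esub> a = \<top>\<^bsub>D\<^esub>))"

definition countably_compact_algebra :: "'d gorder \<Rightarrow> bool" where
  "countably_compact_algebra D \<longleftrightarrow>
     (\<forall>c :: nat \<Rightarrow> 'd. range c \<subseteq> carrier D \<and> \<Squnion>\<^bsub>D\<^esub>(range c) = \<top>\<^bsub>D\<^esub> \<longrightarrow>
        (\<exists>I. finite I \<and> \<Squnion>\<^bsub>D\<^esub>(c ` I) = \<top>\<^bsub>D\<^esub>))"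

definition alexandrov_hom :: "'d gorder \<Rightarrow> 'e gorder \<Rightarrow> ('d \<Rightarrow> 'e) \<Rightarrow> bool" where
  "alexandrov_hom D E f \<longleftrightarrow> lattice_hom D E f \<and>
     (\<forall>S. countable S \<and> S \<subseteq> carrier D \<longrightarrow> f (\<Squnion>\<^bsub>D\<^esub>S) = \<Squnion>\<^bsub>E\<^esub>(f ` S))"

type_synonym 'd lattice_cat = "('d gorder, ('d gorder, 'd) arrow) cat"

definition AlexAlg :: "'d lattice_cat" where
  "AlexAlg = concrete_category carrier {D. alexandrov_algebra D} alexandrov_hom"

definition AlexAlg_c :: "'d lattice_cat" where
  "AlexAlg_c = full_subcategory AlexAlg countably_compact_algebra"


section \<open>Compact Hausdorff spaces and the functor Coz\<close>

type_synonym 'a space_cat = "('a topology, ('a topology, 'a) arrow) cat"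

definition CHaus :: "'a space_cat" where
  "CHaus = concrete_category topspace {X. compact_space X \<and> Hausdorff_space X} continuous_map"

definition Coz :: "'a topology \<Rightarrow> 'a set gorder" where
  "Coz X = \<lparr>carrier = {{x \<in> topspace X. f x \<noteq> 0} | f. continuous_map X euclideanreal f},
            eq = (=), le = (\<subseteq>)\<rparr>"

definition Coz_functor ::
    "('a topology, ('a topology, 'a) arrow, 'a set gorder, ('a set gorder, 'a set) arrow) functor_data"
  where
  "Coz_functor =
     \<lparr>fobj = Coz,
      farr = (\<lambda>f. Arrow (Coz (tgt f))
                    (\<lambda>V\<in>carrier (Coz (tgt f)). mapping f -` V \<inter> topspace (src f))
                    (Coz (src f)))\<rparr>"


section \<open>The functors C and Max\<close>

text \<open>For a Grothendieck topology whose covering sieves are those containing a countable family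
  with the given join, primality of a filter only has to be tested on countable families; the
  empty family is among them, so \<open>\<bottom>\<close> is in no such filter.\<close>

definition countably_prime_filter :: "'d gorder \<Rightarrow> 'd set \<Rightarrow> bool" where
  "countably_prime_filter D F \<longleftrightarrow> lattice_filter D F \<and>
     (\<forall>S. countable S \<and> S \<subseteq> carrier D \<and> \<Squnion>\<^bsub>D\<^esub>S \<in> F \<longrightarrow> (\<exists>s\<in>S. s \<in> F))"

text \<open>The generating families of the two topologies below contain the set of all points
  (take \<open>d = \<top>\<close>), so \<^const>\<open>topspace\<close> is as intended.\<close>

definition filter_space :: "'d gorder \<Rightarrow> 'd set topology" where
  "filter_space D =
     topology_generated_by {{F. countably_prime_filter D F \<and> d \<in> F} | d. d \<in> carrier D}"

definition max_space :: "'d gorder \<Rightarrow> 'd set topology" where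
  "max_space D =
     topology_generated_by {{M. maximal_lattice_ideal D M \<and> d \<notin> M} | d. d \<in> carrier D}"

definition preimage_functor ::
    "('d gorder \<Rightarrow> 'd set topology) \<Rightarrow>
      ('d gorder, ('d gorder, 'd) arrow, 'd set topology, ('d set topology, 'd set) arrow) functor_data"
  where
  "preimage_functor Sp =
     \<lparr>fobj = Sp,
      farr = (\<lambda>f. Arrow (Sp (tgt f))
                    (\<lambda>P\<in>topspace (Sp (tgt f)). mapping f -` P \<inter> carrier (src f))
                    (Sp (src f)))\<rparr>"

definition C_functor ::
    "('d gorder, ('d gorder, 'd) arrow, 'd set topology, ('d set topology, 'd set) arrow) functor_data"
  where "C_functor = preimage_functor filter_space"

definition Max_functor ::
    "('d gorder, ('d gorder, 'd) arrow, 'd set topology, ('d set topology, 'd set) arrow) functor_data"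
  where "Max_functor = preimage_functor max_space"

text \<open>A space whose lattice of cozero sets is isomorphic to a lattice on the type \<open>'d\<close> is
  homeomorphic to the space of maximal ideals of that lattice, so it is no restriction to look
  for it among the topologies on \<open>'d set\<close>.\<close>

definition CHDLat :: "'d lattice_cat" where
  "CHDLat = concrete_category carrier
     {D. distributive_lattice D \<and> conjunctive_lattice D \<and>
         (\<exists>X :: 'd set topology. compact_space X \<and> Hausdorff_space X \<and> isomorphic_lattices D (Coz X))}
     maximal_hom"


section \<open>Identity functors up to a change of carrier type\<close>

text \<open>The points of \<open>C (Coz X)\<close> for \<open>X :: 'a topology\<close> have type \<open>'a set set\<close>, and dually for
  \<open>Coz (C D)\<close>. Hence the two composites are compared not with the identity functor on objects over
  \<open>'a\<close> but with the functor that renames every element \<open>x\<close> of an object to \<open>{{x}}\<close>.\<close>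

definition raise :: "'a \<Rightarrow> 'a set set" where
  "raise x = {{x}}"

definition lower :: "'a set set \<Rightarrow> 'a" where
  "lower z = the_elem (the_elem z)"

lemma lower_raise [simp]: "lower (raise x) = x"
  by (simp add: lower_def raise_def)

definition raise_space :: "'a topology \<Rightarrow> 'a set set topology" where
  "raise_space X = pullback_topology (raise ` topspace X) lower X"

definition raise_lattice :: "'d gorder \<Rightarrow> 'd set set gorder" where
  "raise_lattice D = \<lparr>carrier = raise ` carrier D, eq = (=), le = (\<lambda>a b. lower a \<sqsubseteq>\<^bsub>D\<^esub> lower b)\<rparr>"

definition raise_functor ::
    "('o \<Rightarrow> 'p set) \<Rightarrow> ('o \<Rightarrow> 'o2) \<Rightarrow>
      ('o, ('o, 'p) arrow, 'o2, ('o2, 'p set set) arrow) functor_data" where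
  "raise_functor U R =
     \<lparr>fobj = R,
      farr = (\<lambda>f. Arrow (R (src f))
                    (\<lambda>z\<in>raise ` U (src f). raise (mapping f (lower z)))
                    (R (tgt f)))\<rparr>"

definition Raise_CHaus ::
    "('a topology, ('a topology, 'a) arrow,
      'a set set topology, ('a set set topology, 'a set set) arrow) functor_data" where
  "Raise_CHaus = raise_functor topspace raise_space"

definition Raise_AlexAlg ::
    "('d gorder, ('d gorder, 'd) arrow,
      'd set set gorder, ('d set set gorder, 'd set set) arrow) functor_data" where
  "Raise_AlexAlg = raise_functor carrier raise_lattice"

lemma homeomorphic_map_raise: "homeomorphic_map X (raise_space X) raise"
proof -
  have 1: "continuous_map X (raise_space X) raise"
    unfolding raise_space_def
    by (rule continuous_map_pullback') (auto simp: o_def)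
  have 2: "continuous_map (raise_space X) X lower"
    unfolding raise_space_def
    using continuous_map_pullback[of X X id] by (simp add: o_def id_def)
  have "homeomorphic_maps X (raise_space X) raise lower"
    unfolding homeomorphic_maps_def using 1 2
    by (auto simp: raise_space_def topspace_pullback_topology)
  then show ?thesis
    using homeomorphic_maps_map by blast
qed

lemma bij_betw_raise_lattice: "bij_betw raise (carrier D) (carrier (raise_lattice D))"
  by (auto simp: raise_lattice_def raise_def bij_betw_def inj_on_def)

lemma le_raise_lattice: "raise a \<sqsubseteq>\<^bsub>raise_lattice D\<^esub> raise b \<longleftrightarrow> a \<sqsubseteq>\<^bsub>D\<^esub> b"
  by (simp add: raise_lattice_def)

end

theory Submission
  imports Defs
begin

text \<open>In a countably compact Alexandrov algebra \<open>D\<close> the complements of the countably prime filters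
  are exactly the maximal ideals: countable compactness makes the complement of a maximal ideal
  countably prime, and the sequences \<open>b\<^sub>n \<sqinter> c\<^sub>n = \<bottom>\<close>, \<open>b\<^sub>n \<squnion> a = \<top>\<close> make the complement of a
  countably prime filter maximal. Hence there are enough points, \<open>C D\<close> is compact, and normality
  makes it Hausdorff. The same sequences show that each basic open set of \<open>C D\<close> is a countable
  union of closed sets, hence cozero by Urysohn's lemma; conversely a cozero set is a countable
  union of compact sets, each covered by a basic open set inside the cozero set. So \<open>D \<cong> Coz (C D)\<close>, while
  \<open>X \<cong> C (Coz X)\<close> because a countably prime filter of cozero sets converges to exactly one point.\<close>

section \<open>Categories and functors\<close>

text \<open>Zorn's lemma yields maximal ideals but says nothing about countable joins; countably
  prime filters pull back along homomorphisms, but there is no direct way to produce one.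
  Complementation lets each notion supply what the other lacks, and it is also the comparison
  between \<open>C\<close> and \<open>Max\<close>. The remaining lattice theory is done once, in
  sets. \<open>Coz X\<close>, an algebra with its basic open sets, a renamed algebra and an object
  of \<open>CHDLat\<close> are all order isomorphic to some lattice of cozero sets. The order
  determines joins and meets, so \<open>cozero_representation\<close> verifies the algebra axioms as
  identities between sets, and \<open>alexandrov_homI\<close> reduces the homomorphism laws to
  properties of preimages. The composites of the two functors change the carrier type, which is why
  the natural isomorphisms start from renaming functors; a renamed object is represented on the same
  space, so it needs no separate verification.\<close>

lemma concrete_category_simps [simp]:
  "Obj (concrete_category U Os H) = Os"
  "Arr (concrete_category U Os H) =
     {Arrow X f Y | X f Y. X \<in> Os \<and> Y \<in> Os \<and> f \<in> extensional (U X) \<and> H X Y f}"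
  "Dom (concrete_category U Os H) = src"
  "Cod (concrete_category U Os H) = tgt"
  "Ide (concrete_category U Os H) X = Arrow X (\<lambda>x\<in>U X. x) X"
  "Cmp (concrete_category U Os H) a b =
     Arrow (src b) (compose (U (src b)) (mapping a) (mapping b)) (tgt a)"
  by (simp_all add: concrete_category_def)

lemma full_subcategory_concrete:
  "full_subcategory (concrete_category U Os H) P = concrete_category U {X \<in> Os. P X} H"
  by (auto simp: full_subcategory_def concrete_category_def)

text \<open>The unit laws are equalities of functions because the maps are extensional; the unit law
  on the left and associativity also need that a map sends the source carrier into the target
  carrier.\<close>

lemma category_concrete:
  assumes maps: "\<And>X Y f. X \<in> Os \<Longrightarrow> Y \<in> Os \<Longrightarrow> H X Y f \<Longrightarrow> f \<in> U X \<rightarrow> U Y"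
    and ident: "\<And>X. X \<in> Os \<Longrightarrow> H X X (\<lambda>x\<in>U X. x)"
    and comp: "\<And>X Y Z f g. X \<in> Os \<Longrightarrow> Y \<in> Os \<Longrightarrow> Z \<in> Os \<Longrightarrow> H X Y f \<Longrightarrow> H Y Z g
      \<Longrightarrow> H X Z (compose (U X) g f)"
  shows "category (concrete_category U Os H)"
proof -
  have "compose (U X) f (\<lambda>x\<in>U X. x) = f" if "f \<in> extensional (U X)" for X and f :: "'b \<Rightarrow> 'b"
    using that by (auto simp: compose_def extensional_def fun_eq_iff)
  moreover have "compose (U X) (\<lambda>x\<in>U Y. x) f = f"
    if "f \<in> extensional (U X)" "X \<in> Os" "Y \<in> Os" "H X Y f" for X Y f
    using that maps[of X Y f] by (fastforce simp: compose_def extensional_def fun_eq_iff Pi_iff)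
  moreover have "compose (U X) h (compose (U X) g f) = compose (U X) (compose (U Y) h g) f"
    if "X \<in> Os" "Y \<in> Os" "H X Y f" for X Y f and g h :: "'b \<Rightarrow> 'b"
    using that maps[of X Y f] by (auto simp: compose_def fun_eq_iff Pi_iff)
  ultimately show ?thesis
    by (auto simp: category_def ident comp)
qed

lemma iso_arrow_concrete:
  assumes "X \<in> Os" "Y \<in> Os" "f \<in> extensional (U X)" "g \<in> extensional (U Y)"
    "H X Y f" "H Y X g" "\<And>x. x \<in> U X \<Longrightarrow> g (f x) = x" "\<And>y. y \<in> U Y \<Longrightarrow> f (g y) = y"
  shows "iso_arrow (concrete_category U Os H) (Arrow X f Y)"
  unfolding iso_arrow_def
proof (intro conjI bexI)
  show "Arrow Y g X \<in> Arr (concrete_category U Os H)"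
    using assms by auto
qed (use assms in \<open>auto simp: compose_def fun_eq_iff\<close>)

section \<open>Opposite categories and the symmetry of natural isomorphism\<close>

lemma opposite_simps [simp]:
  "Obj (opposite A) = Obj A" "Arr (opposite A) = Arr A" "Dom (opposite A) = Cod A"
  "Cod (opposite A) = Dom A" "Ide (opposite A) = Ide A" "Cmp (opposite A) a b = Cmp A b a"
  by (simp_all add: opposite_def)

lemma opposite_opposite [simp]: "opposite (opposite A) = A"
  by (simp add: opposite_def)

lemma category_opposite: "category A \<Longrightarrow> category (opposite A)"
  unfolding category_def opposite_simps by (intro conjI ballI impI) (metis)+

lemma is_functor_opposite: "is_functor A B F \<Longrightarrow> is_functor (opposite A) (opposite B) F"
  by (auto simp: is_functor_def intro: category_opposite)

lemma is_functor_comp: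
  assumes "is_functor A B F" "is_functor B C G"
  shows "is_functor A C (functor_comp G F)"
  using assms by (auto simp: is_functor_def functor_comp_def)

lemma iso_arrow_opposite: "iso_arrow A a \<Longrightarrow> iso_arrow (opposite A) a"
  by (auto simp: iso_arrow_def)

lemma natural_iso_opposite:
  assumes "natural_iso A B F G \<eta>"
  shows "natural_iso (opposite A) (opposite B) G F \<eta>"
  using assms by (auto simp: natural_iso_def intro: is_functor_opposite iso_arrow_opposite)

text \<open>Componentwise inverses form a natural family: cancel \<open>\<eta>\<close> on both sides
  of its naturality square. Symmetry is needed because passing to opposite categories swaps the two
  functors.\<close>

lemma naturally_isomorphic_sym:
  assumes "naturally_isomorphic A B F G"
  shows "naturally_isomorphic A B G F"
proof -
  obtain \<eta> where \<eta>: "natural_iso A B F G \<eta>"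
    using assms by (auto simp: naturally_isomorphic_def)
  have F: "is_functor A B F" and G: "is_functor A B G" and B: "category B" and A: "category A"
    using \<eta> by (auto simp: natural_iso_def is_functor_def)
  have "\<forall>X\<in>Obj A. \<exists>b. b \<in> Arr B \<and> Dom B b = fobj G X \<and> Cod B b = fobj F X \<and>
      Cmp B b (\<eta> X) = Ide B (fobj F X) \<and> Cmp B (\<eta> X) b = Ide B (fobj G X)"
    using \<eta> by (auto simp: natural_iso_def iso_arrow_def) metis
  then obtain \<theta> where \<theta>: "\<And>X. X \<in> Obj A \<Longrightarrow> \<theta> X \<in> Arr B \<and> Dom B (\<theta> X) = fobj G X \<and>
      Cod B (\<theta> X) = fobj F X \<and> Cmp B (\<theta> X) (\<eta> X) = Ide B (fobj F X) \<and>
      Cmp B (\<eta> X) (\<theta> X) = Ide B (fobj G X)"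
    by metis
  have \<eta>': "\<eta> X \<in> Arr B \<and> Dom B (\<eta> X) = fobj F X \<and> Cod B (\<eta> X) = fobj G X" if "X \<in> Obj A" for X
    using \<eta> that by (auto simp: natural_iso_def iso_arrow_def)
  have "natural_iso A B G F \<theta>"
    unfolding natural_iso_def
  proof (intro conjI ballI F G)
    fix X assume X: "X \<in> Obj A"
    show "iso_arrow B (\<theta> X)"
      unfolding iso_arrow_def using \<theta>[OF X] \<eta>'[OF X] by force
    show "Dom B (\<theta> X) = fobj G X" "Cod B (\<theta> X) = fobj F X"
      using \<theta>[OF X] by auto
  next
    fix a assume a: "a \<in> Arr A"
    define X where "X = Dom A a"
    define Y where "Y = Cod A a"
    have X: "X \<in> Obj A" and Y: "Y \<in> Obj A"
      using A a by (auto simp: category_def X_def Y_def)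
    have Fa: "farr F a \<in> Arr B" "Dom B (farr F a) = fobj F X" "Cod B (farr F a) = fobj F Y"
      using F a by (auto simp: is_functor_def X_def Y_def)
    have Ga: "farr G a \<in> Arr B" "Dom B (farr G a) = fobj G X" "Cod B (farr G a) = fobj G Y"
      using G a by (auto simp: is_functor_def X_def Y_def)
    have nat: "Cmp B (farr G a) (\<eta> X) = Cmp B (\<eta> Y) (farr F a)"
      using \<eta> a by (auto simp: natural_iso_def X_def Y_def)
    have assoc: "Cmp B h (Cmp B g f) = Cmp B (Cmp B h g) f"
      if "f \<in> Arr B" "g \<in> Arr B" "h \<in> Arr B" "Cod B f = Dom B g" "Cod B g = Dom B h" for f g h
      using B that unfolding category_def by blast
    have closed: "Cmp B g f \<in> Arr B \<and> Dom B (Cmp B g f) = Dom B f \<and> Cod B (Cmp B g f) = Cod B g"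
      if "f \<in> Arr B" "g \<in> Arr B" "Cod B f = Dom B g" for f g
      using B that unfolding category_def by blast
    have ident: "Cmp B f (Ide B (Dom B f)) = f" "Cmp B (Ide B (Cod B f)) f = f"
      if "f \<in> Arr B" for f
      using B that unfolding category_def by blast+
    note facts = \<theta>[OF X] \<theta>[OF Y] \<eta>'[OF X] \<eta>'[OF Y] Fa Ga
    \<comment> \<open>Insert the identity \<open>\<theta> Y\<close> after \<open>\<eta> Y\<close>,
      move \<open>\<eta>\<close> across by naturality, then cancel \<open>\<eta> X\<close> after
      \<open>\<theta> X\<close>.\<close>
    have "Cmp B (farr F a) (\<theta> X) = Cmp B (Cmp B (Cmp B (\<theta> Y) (\<eta> Y)) (farr F a)) (\<theta> X)"
      using facts ident(2)[of "farr F a"] by simp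
    also have "\<dots> = Cmp B (Cmp B (\<theta> Y) (Cmp B (farr G a) (\<eta> X))) (\<theta> X)"
      using facts assoc[of "farr F a" "\<eta> Y" "\<theta> Y"] nat by simp
    also have "\<dots> = Cmp B (Cmp B (Cmp B (\<theta> Y) (farr G a)) (\<eta> X)) (\<theta> X)"
      using facts assoc[of "\<eta> X" "farr G a" "\<theta> Y"] by simp
    also have "\<dots> = Cmp B (Cmp B (\<theta> Y) (farr G a)) (Cmp B (\<eta> X) (\<theta> X))"
      using facts assoc[of "\<theta> X" "\<eta> X" "Cmp B (\<theta> Y) (farr G a)"] closed[of "farr G a" "\<theta> Y"] by simp
    also have "\<dots> = Cmp B (\<theta> Y) (farr G a)"
      using facts ident(1)[of "Cmp B (\<theta> Y) (farr G a)"] closed[of "farr G a" "\<theta> Y"] by simp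
    finally show "Cmp B (farr F a) (\<theta> (Dom A a)) = Cmp B (\<theta> (Cod A a)) (farr G a)"
      by (simp add: X_def Y_def)
  qed
  then show ?thesis
    by (auto simp: naturally_isomorphic_def)
qed

section \<open>Renaming functors and preimage functors\<close>

lemma is_functor_raise:
  assumes "category (concrete_category U Os H)" "category (concrete_category U' Os' H')"
    and maps: "\<And>X Y f. X \<in> Os \<Longrightarrow> Y \<in> Os \<Longrightarrow> H X Y f \<Longrightarrow> f \<in> U X \<rightarrow> U Y"
    and obj: "\<And>X. X \<in> Os \<Longrightarrow> R X \<in> Os'" "\<And>X. X \<in> Os \<Longrightarrow> U' (R X) = raise ` U X"
    and arr: "\<And>X Y f. X \<in> Os \<Longrightarrow> Y \<in> Os \<Longrightarrow> H X Y f
      \<Longrightarrow> H' (R X) (R Y) (\<lambda>z\<in>raise ` U X. raise (f (lower z)))"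
  shows "is_functor (concrete_category U Os H) (concrete_category U' Os' H') (raise_functor U R)"
proof -
  have "(\<lambda>z\<in>raise ` U X. raise (compose (U X) g f (lower z))) =
      compose (raise ` U X) (\<lambda>z\<in>raise ` U Y. raise (g (lower z))) (\<lambda>z\<in>raise ` U X. raise (f (lower z)))"
    if "X \<in> Os" "Y \<in> Os" "H X Y f" for X Y f and g :: "'b \<Rightarrow> 'b"
    using maps[OF that] by (auto simp: fun_eq_iff compose_def)
  moreover have "(\<lambda>z\<in>raise ` U X. raise ((\<lambda>x\<in>U X. x) (lower z))) = (\<lambda>z\<in>raise ` U X. z)" for X
    by (auto simp: fun_eq_iff)
  ultimately show ?thesis
    using assms(1,2) obj arr by (auto simp: is_functor_def raise_functor_def)
qed

text \<open>Shared by \<open>C\<close> and \<open>Max\<close>. The preimage is cut down to the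
  carrier, so identities are preserved only because every point of \<open>Sp D\<close> is a subset
  of \<open>carrier D\<close>.\<close>

lemma is_functor_preimage:
  assumes "category (concrete_category carrier Os H)"
    "category (concrete_category topspace Os' continuous_map)"
    and maps: "\<And>D E f. D \<in> Os \<Longrightarrow> E \<in> Os \<Longrightarrow> H D E f \<Longrightarrow> f \<in> carrier D \<rightarrow> carrier E"
    and obj: "\<And>D. D \<in> Os \<Longrightarrow> Sp D \<in> Os'" "\<And>D P. D \<in> Os \<Longrightarrow> P \<in> topspace (Sp D) \<Longrightarrow> P \<subseteq> carrier D"
    and arr: "\<And>D E f. D \<in> Os \<Longrightarrow> E \<in> Os \<Longrightarrow> H D E f
      \<Longrightarrow> continuous_map (Sp E) (Sp D) (\<lambda>P. f -` P \<inter> carrier D)"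
  shows "is_functor (concrete_category carrier Os H)
      (opposite (concrete_category topspace Os' continuous_map)) (preimage_functor Sp)"
proof -
  have arr': "continuous_map (Sp E) (Sp D) (\<lambda>P\<in>topspace (Sp E). f -` P \<inter> carrier D)"
    if "D \<in> Os" "E \<in> Os" "H D E f" for D E f
    by (rule continuous_map_eq[OF arr[OF that]]) auto
  have "(\<lambda>P\<in>topspace (Sp E'). compose (carrier D) g f -` P \<inter> carrier D) =
      compose (topspace (Sp E')) (\<lambda>P\<in>topspace (Sp E). f -` P \<inter> carrier D)
        (\<lambda>P\<in>topspace (Sp E'). g -` P \<inter> carrier E)"
    if "D \<in> Os" "E \<in> Os" "E' \<in> Os" "H D E f" "H E E' g" for D E E' f g
  proof -
    have "compose (carrier D) g f -` P \<inter> carrier D = f -` (g -` P \<inter> carrier E) \<inter> carrier D" for P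
      using maps[OF that(1,2,4)] by (auto simp: compose_def)
    moreover have "g -` P \<inter> carrier E \<in> topspace (Sp E)" if "P \<in> topspace (Sp E')" for P
      using continuous_map_image_subset_topspace[OF arr[OF \<open>E \<in> Os\<close> \<open>E' \<in> Os\<close> \<open>H E E' g\<close>]] that by auto
    ultimately show ?thesis
      by (auto simp: fun_eq_iff compose_def)
  qed
  moreover have "(\<lambda>P\<in>topspace (Sp D). (\<lambda>x\<in>carrier D. x) -` P \<inter> carrier D) = (\<lambda>P\<in>topspace (Sp D). P)"
    if "D \<in> Os" for D
  proof -
    have "(\<lambda>x\<in>carrier D. x) -` P \<inter> carrier D = P \<inter> carrier D" for P
      by auto
    then show ?thesis
      using obj(2)[OF that] by (intro ext) (simp add: restrict_def Int_absorb2)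
  qed
  ultimately show ?thesis
    using category_opposite[OF assms(2)] assms(1) obj arr'
    by (auto simp: is_functor_def preimage_functor_def)
qed

section \<open>Cozero sets\<close>

lemma Coz_simps [simp]:
  "eq (Coz X) = (=)" "le (Coz X) = (\<subseteq>)"
  by (simp_all add: Coz_def)

lemma in_Coz_iff:
  "V \<in> carrier (Coz X) \<longleftrightarrow>
    (\<exists>f. continuous_map X euclideanreal f \<and> V = {x \<in> topspace X. f x \<noteq> 0})"
  by (auto simp: Coz_def)

lemma CozI:
  assumes "continuous_map X euclideanreal f" "V = {x \<in> topspace X. f x \<noteq> 0}"
  shows "V \<in> carrier (Coz X)"
  using assms by (auto simp: Coz_def)

lemma CozE:
  assumes "V \<in> carrier (Coz X)"
  obtains f where "continuous_map X euclideanreal f" "V = {x \<in> topspace X. f x \<noteq> 0}"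
  using assms by (auto simp: Coz_def)

lemma Coz_subset_topspace: "V \<in> carrier (Coz X) \<Longrightarrow> V \<subseteq> topspace X"
  by (auto simp: Coz_def)

lemma openin_Coz:
  assumes "V \<in> carrier (Coz X)"
  shows "openin X V"
proof -
  obtain f where f: "continuous_map X euclideanreal f" "V = {x \<in> topspace X. f x \<noteq> 0}"
    using assms by (rule CozE)
  have "openin X {x \<in> topspace X. f x \<in> - {0}}"
    using f(1) by (rule openin_continuous_map_preimage) (auto intro: open_Compl)
  then show ?thesis
    using f(2) by simp
qed

text \<open>The function \<open>max 0 (f x - g x)\<close> is nonzero exactly where
  \<open>g x < f x\<close>. Normality and exhaustion use cozero sets in this form.\<close>

lemma Coz_superlevel:
  assumes "continuous_map X euclideanreal f" "continuous_map X euclideanreal g"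
  shows "{x \<in> topspace X. g x < f x} \<in> carrier (Coz X)"
  by (rule CozI[of _ "\<lambda>x. max 0 (f x - g x)"])
    (auto intro!: continuous_map_real_max continuous_map_diff assms)

lemma Coz_empty: "{} \<in> carrier (Coz X)"
  by (rule CozI[of _ "\<lambda>_. 0"]) auto

lemma Coz_topspace: "topspace X \<in> carrier (Coz X)"
  by (rule CozI[of _ "\<lambda>_. 1"]) auto

lemma Coz_Int:
  assumes "V \<in> carrier (Coz X)" "W \<in> carrier (Coz X)"
  shows "V \<inter> W \<in> carrier (Coz X)"
proof -
  obtain f g where "continuous_map X euclideanreal f" "V = {x \<in> topspace X. f x \<noteq> 0}"
    "continuous_map X euclideanreal g" "W = {x \<in> topspace X. g x \<noteq> 0}"
    using assms unfolding in_Coz_iff by blast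
  then show ?thesis
    by (intro CozI[of _ "\<lambda>x. f x * g x"]) (auto intro: continuous_map_real_mult)
qed

text \<open>A weighted sum of the truncations of |f n| is continuous, and having nonnegative terms
  it vanishes exactly where every \<open>f n\<close> does.\<close>

lemma Coz_UN_nat:
  assumes "\<And>n::nat. V n \<in> carrier (Coz X)"
  shows "(\<Union>n. V n) \<in> carrier (Coz X)"
proof -
  obtain f where f: "\<And>n. continuous_map X euclideanreal (f n)"
    "\<And>n. V n = {x \<in> topspace X. f n x \<noteq> 0}"
    using assms unfolding in_Coz_iff by metis
  \<comment> \<open>Truncation at 1 bounds the n-th term by \<open>(1/2) ^ n\<close> independently
    of \<open>x\<close>, so the series converges uniformly; the weight is positive, so no zero is
    added.\<close>
  define h where "h n x = min \<bar>f n x\<bar> 1 * (1/2) ^ n" for n x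
  have h0: "0 \<le> h n x" "h n x \<le> (1/2) ^ n" "h n x = 0 \<longleftrightarrow> f n x = 0" for n x
    by (auto simp: h_def min_def)
  have sum_h: "summable (\<lambda>n. h n x)" for x
    by (rule summable_comparison_test'[of "\<lambda>n. (1/2) ^ n" 0]) (use h0 in auto)
  have cont_h: "continuous_map X euclideanreal (h n)" for n
    unfolding h_def
    by (intro continuous_map_real_mult continuous_map_real_min continuous_map_real_abs f) auto
  have "uniform_limit UNIV (\<lambda>n x. \<Sum>i<n. h i x) (\<lambda>x. \<Sum>i. h i x) sequentially"
    by (rule Weierstrass_m_test[where M="\<lambda>n. (1/2) ^ n"]) (use h0 in auto)
  then have lim: "\<forall>\<^sub>F n in sequentially. \<forall>x\<in>topspace X. dist (\<Sum>i<n. h i x) (\<Sum>i. h i x) < e"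
    if "e > 0" for e
  proof -
    have "\<forall>\<^sub>F n in sequentially. \<forall>x\<in>UNIV. dist (\<Sum>i<n. h i x) (\<Sum>i. h i x) < e"
      using \<open>uniform_limit UNIV _ _ _\<close> that by (simp add: uniform_limit_iff)
    then show ?thesis
      by (rule eventually_mono) simp
  qed
  \<comment> \<open>\<open>Met_TC.mtopology\<close> is the euclidean topology of the reals, seen as
    the topology of a metric, as the uniform limit theorem wants it.\<close>
  have "continuous_map X Met_TC.mtopology (\<lambda>x. \<Sum>i. h i x)"
  proof (rule Met_TC.continuous_map_uniform_limit)
    show "\<forall>\<^sub>F n in sequentially. continuous_map X Met_TC.mtopology (\<lambda>x. \<Sum>i<n. h i x)"
      by (auto intro!: always_eventually continuous_map_sum cont_h)
  qed (use lim in auto)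
  moreover have "(\<Sum>i. h i x) \<noteq> 0 \<longleftrightarrow> (\<exists>n. f n x \<noteq> 0)" for x
    using suminf_eq_zero_iff[OF sum_h h0(1)] h0(3) by auto
  ultimately show ?thesis
    by (intro CozI[of _ "\<lambda>x. \<Sum>i. h i x"]) (auto simp: f(2))
qed

lemma Coz_Union:
  assumes "countable \<V>" "\<V> \<subseteq> carrier (Coz X)"
  shows "\<Union>\<V> \<in> carrier (Coz X)"
proof (cases "\<V> = {}")
  case True
  then show ?thesis by (simp add: Coz_empty)
next
  case False
  then show ?thesis
    using Coz_UN_nat[of "from_nat_into \<V>" X] assms by (metis from_nat_into range_from_nat_into subsetD)
qed

lemma Coz_vimage:
  assumes "continuous_map X Y f" "V \<in> carrier (Coz Y)"
  shows "f -` V \<inter> topspace X \<in> carrier (Coz X)"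
proof -
  obtain g where g: "continuous_map Y euclideanreal g" "V = {x \<in> topspace Y. g x \<noteq> 0}"
    using assms(2) by (rule CozE)
  show ?thesis
    by (rule CozI[OF continuous_map_compose[OF assms(1) g(1)]])
      (use continuous_map_image_subset_topspace[OF assms(1)] in \<open>auto simp: g(2)\<close>)
qed

section \<open>Separation and exhaustion by cozero sets\<close>

lemma Coz_normal:
  assumes "A \<in> carrier (Coz X)" "B \<in> carrier (Coz X)" "A \<union> B = topspace X"
  obtains C D where "C \<in> carrier (Coz X)" "D \<in> carrier (Coz X)"
    "C \<union> A = topspace X" "B \<union> D = topspace X" "C \<inter> D = {}"
proof -
  obtain f g where f: "continuous_map X euclideanreal f" "A = {x \<in> topspace X. f x \<noteq> 0}"
    and g: "continuous_map X euclideanreal g" "B = {x \<in> topspace X. g x \<noteq> 0}"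
    using assms(1,2) unfolding in_Coz_iff by blast
  show thesis
  proof
    \<comment> \<open>Off \<open>A\<close> we have \<open>f x = 0\<close> and
      \<open>g x \<noteq> 0\<close>, so the first set together with \<open>A\<close> covers the
      space; the second set does the same for \<open>B\<close>. The two strict inequalities exclude
      each other.\<close>
    show "{x \<in> topspace X. \<bar>f x\<bar> < \<bar>g x\<bar>} \<in> carrier (Coz X)"
      "{x \<in> topspace X. \<bar>g x\<bar> < \<bar>f x\<bar>} \<in> carrier (Coz X)"
      by (intro Coz_superlevel continuous_map_real_abs f g)+
  qed (use assms(3) f g in auto)
qed

text \<open>Level sets of |f| on both sides of thresholds tending to 0. This supplies the sequences
  in the definition of an Alexandrov algebra, and it is used again wherever a cozero set has to be
  approximated from inside.\<close>

lemma Coz_exhaustion: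
  assumes "V \<in> carrier (Coz X)"
  shows "\<exists>B C :: nat \<Rightarrow> 'a set. (\<forall>n. B n \<in> carrier (Coz X)) \<and> (\<forall>n. C n \<in> carrier (Coz X)) \<and>
    (\<Union>n. C n) = V \<and> (\<forall>n. B n \<inter> C n = {}) \<and> (\<forall>n. B n \<union> V = topspace X)"
proof -
  obtain f where f: "continuous_map X euclideanreal f" "V = {x \<in> topspace X. f x \<noteq> 0}"
    using assms by (rule CozE)
  \<comment> \<open>\<open>Suc n\<close> keeps the threshold positive: \<open>inverse 0 = 0\<close>
    would make the set for \<open>n = 0\<close> empty, and it has to contain the zeros of
    \<open>f\<close>.\<close>
  define B where "B n = {x \<in> topspace X. \<bar>f x\<bar> < inverse (real (Suc n))}" for n
  define C where "C n = {x \<in> topspace X. inverse (real (Suc n)) < \<bar>f x\<bar>}" for n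
  have "B n \<in> carrier (Coz X)" "C n \<in> carrier (Coz X)" for n
    unfolding B_def C_def
    by (intro Coz_superlevel continuous_map_real_abs f continuous_map_const[THEN iffD2]; simp)+
  moreover have "(\<Union>n. C n) = V"
  proof
    show "(\<Union>n. C n) \<subseteq> V"
      using f(2) by (auto simp: C_def field_simps)
    show "V \<subseteq> (\<Union>n. C n)"
    proof
      fix x assume "x \<in> V"
      then obtain n where "inverse (real (Suc n)) < \<bar>f x\<bar>"
        using reals_Archimedean[of "\<bar>f x\<bar>"] f(2) by auto
      then show "x \<in> (\<Union>n. C n)"
        using \<open>x \<in> V\<close> f(2) by (auto simp: C_def)
    qed
  qed
  moreover have "B n \<inter> C n = {}" "B n \<union> V = topspace X" for n
    using f(2) by (auto simp: B_def C_def)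
  ultimately show ?thesis
    by blast
qed

text \<open>A Urysohn function with value 1 on \<open>K\<close> and 0 off \<open>W\<close> has a
  cozero set in between.\<close>

lemma Coz_between:
  assumes "normal_space X" "closedin X K" "openin X W" "K \<subseteq> W"
  obtains V where "V \<in> carrier (Coz X)" "K \<subseteq> V" "V \<subseteq> W"
proof -
  have "closedin X (topspace X - W)" "disjnt K (topspace X - W)"
    using assms by (auto simp: disjnt_def)
  then obtain f where f: "continuous_map X euclideanreal f" "f ` K \<subseteq> {1}" "f ` (topspace X - W) \<subseteq> {0}"
    using Urysohn_lemma_alt[OF assms(1,2)] by metis
  show thesis
  proof
    show "{x \<in> topspace X. f x \<noteq> 0} \<in> carrier (Coz X)"
      using f(1) by (rule CozI) simp
    show "K \<subseteq> {x \<in> topspace X. f x \<noteq> 0}"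
      using f(2) closedin_subset[OF assms(2)] by force
  qed (use f(3) in auto)
qed

lemma Coz_base:
  assumes "compact_space X" "Hausdorff_space X" "openin X W" "x \<in> W"
  obtains V where "V \<in> carrier (Coz X)" "x \<in> V" "V \<subseteq> W"
proof -
  have "closedin X {x}"
    using assms openin_subset by (metis closedin_Hausdorff_singleton subsetD)
  then show thesis
    using Coz_between[of X "{x}" W] assms compact_Hausdorff_or_regular_imp_normal_space that by auto
qed

section \<open>Lattices represented by cozero sets\<close>

text \<open>Only the order is represented, with no assumption on joins and meets; the order
  determines them and they turn out to be unions and intersections. The condition on
  \<open>eq\<close> is there because a \<open>gorder\<close> carries its own equality.\<close>

locale cozero_representation =
  fixes X :: "'p topology" and E :: "'e gorder" (structure) and \<phi> :: "'e \<Rightarrow> 'p set"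
  assumes compact: "compact_space X" and Hausdorff: "Hausdorff_space X"
    and eq_is_eq: "eq E = (=)"
    and bij: "bij_betw \<phi> (carrier E) (carrier (Coz X))"
    and le_iff: "a \<in> carrier E \<Longrightarrow> b \<in> carrier E \<Longrightarrow> a \<sqsubseteq> b \<longleftrightarrow> \<phi> a \<subseteq> \<phi> b"
begin

lemma rep_closed [simp]: "a \<in> carrier E \<Longrightarrow> \<phi> a \<in> carrier (Coz X)"
  using bij by (auto simp: bij_betw_def)

lemma rep_surj: "V \<in> carrier (Coz X) \<Longrightarrow> \<exists>a\<in>carrier E. \<phi> a = V"
  using bij by (metis bij_betw_imp_surj_on imageE)

lemma rep_eq_iff: "a \<in> carrier E \<Longrightarrow> b \<in> carrier E \<Longrightarrow> a = b \<longleftrightarrow> \<phi> a = \<phi> b"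
  using bij by (auto simp: bij_betw_def inj_on_def)

lemma partial_order: "partial_order E"
proof
  show "x .= y" if "x \<sqsubseteq> y" "y \<sqsubseteq> x" "x \<in> carrier E" "y \<in> carrier E" for x y
    using that by (simp add: eq_is_eq le_iff rep_eq_iff)
  show "x \<sqsubseteq> z" if "x \<sqsubseteq> y" "y \<sqsubseteq> z" "x \<in> carrier E" "y \<in> carrier E" "z \<in> carrier E" for x y z
    using that by (simp add: le_iff)
qed (simp_all add: eq_is_eq le_iff)

lemma is_lubI:
  assumes "S \<subseteq> carrier E" "s \<in> carrier E" "\<phi> s = \<Union>(\<phi> ` S)"
  shows "is_lub E s S"
  unfolding least_def Upper_def
proof (intro conjI ballI)
  have *: "x \<in> S \<Longrightarrow> x \<in> carrier E" for x
    using assms(1) by blast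
  show "s \<in> {u. \<forall>x. x \<in> S \<inter> carrier E \<longrightarrow> x \<sqsubseteq> u} \<inter> carrier E"
    using assms(2,3) by (auto simp: le_iff)
  fix u assume "u \<in> {u. \<forall>x. x \<in> S \<inter> carrier E \<longrightarrow> x \<sqsubseteq> u} \<inter> carrier E"
  then have "u \<in> carrier E" "\<And>x. x \<in> S \<Longrightarrow> \<phi> x \<subseteq> \<phi> u"
    using * le_iff by auto
  then show "s \<sqsubseteq> u"
    using assms(2,3) by (simp add: le_iff UN_least)
qed (rule Int_lower2)

lemma is_glbI:
  assumes "a \<in> carrier E" "b \<in> carrier E" "s \<in> carrier E" "\<phi> s = \<phi> a \<inter> \<phi> b"
  shows "is_glb E s {a, b}"
proof -
  have "Lower E {a, b} = {l \<in> carrier E. l \<sqsubseteq> a \<and> l \<sqsubseteq> b}"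
    unfolding Lower_def using assms(1,2) by blast
  then show ?thesis
    using assms by (auto simp: greatest_def) (simp add: le_iff)+
qed

lemma ex_lub:
  assumes "countable S" "S \<subseteq> carrier E"
  shows "\<exists>s\<in>carrier E. \<phi> s = \<Union>(\<phi> ` S) \<and> is_lub E s S"
proof -
  have "\<Union>(\<phi> ` S) \<in> carrier (Coz X)"
    using assms by (intro Coz_Union) auto
  then show ?thesis
    using rep_surj is_lubI[OF assms(2)] by blast
qed

lemma
  assumes "countable S" "S \<subseteq> carrier E"
  shows sup_closed [simp]: "\<Squnion>S \<in> carrier E" and rep_sup: "\<phi> (\<Squnion>S) = \<Union>(\<phi> ` S)"
proof -
  obtain s where s: "s \<in> carrier E" "\<phi> s = \<Union>(\<phi> ` S)" "is_lub E s S"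
    using ex_lub[OF assms] by blast
  \<comment> \<open>\<open>\<Squnion>S\<close> is a least upper bound picked by choice, so its image
    under \<open>\<phi>\<close> is known only after identifying it with \<open>s\<close> by
    uniqueness.\<close>
  then have "\<Squnion>S = s"
    unfolding sup_def using partial_order.least_unique[OF partial_order] by blast
  with s show "\<Squnion>S \<in> carrier E" "\<phi> (\<Squnion>S) = \<Union>(\<phi> ` S)"
    by auto
qed

lemma
  assumes "a \<in> carrier E" "b \<in> carrier E"
  shows join_closed [simp]: "a \<squnion> b \<in> carrier E" and rep_join: "\<phi> (a \<squnion> b) = \<phi> a \<union> \<phi> b"
  using assms rep_sup[of "{a, b}"] sup_closed[of "{a, b}"] by (simp_all add: join_def)

lemma ex_glb:
  assumes "a \<in> carrier E" "b \<in> carrier E"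
  shows "\<exists>s\<in>carrier E. \<phi> s = \<phi> a \<inter> \<phi> b \<and> is_glb E s {a, b}"
  using rep_surj[OF Coz_Int[OF rep_closed rep_closed, OF assms]] is_glbI[OF assms] by blast

lemma
  assumes "a \<in> carrier E" "b \<in> carrier E"
  shows meet_closed [simp]: "a \<sqinter> b \<in> carrier E" and rep_meet: "\<phi> (a \<sqinter> b) = \<phi> a \<inter> \<phi> b"
proof -
  obtain s where s: "s \<in> carrier E" "\<phi> s = \<phi> a \<inter> \<phi> b" "is_glb E s {a, b}"
    using ex_glb[OF assms] by blast
  then have "a \<sqinter> b = s"
    unfolding meet_def inf_def using partial_order.greatest_unique[OF partial_order] by blast
  with s show "a \<sqinter> b \<in> carrier E" "\<phi> (a \<sqinter> b) = \<phi> a \<inter> \<phi> b"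
    by auto
qed

lemma bounded_lattice: "bounded_lattice E"
proof -
  interpret partial_order E
    by (rule partial_order)
  show ?thesis
  proof
    show "\<exists>s. is_lub E s {x, y}" if "x \<in> carrier E" "y \<in> carrier E" for x y
      using ex_lub[of "{x, y}"] that by auto
    show "\<exists>s. is_glb E s {x, y}" if "x \<in> carrier E" "y \<in> carrier E" for x y
      using ex_glb[OF that] by blast
    obtain b where "b \<in> carrier E" "\<phi> b = {}"
      using rep_surj[OF Coz_empty] by blast
    then show "\<exists>x. least E x (carrier E)"
      by (auto simp: least_def le_iff)
    obtain t where "t \<in> carrier E" "\<phi> t = topspace X"
      using rep_surj[OF Coz_topspace] by blast
    then show "\<exists>x. greatest E x (carrier E)"
      using Coz_subset_topspace[OF rep_closed] by (auto simp: greatest_def le_iff)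
  qed
qed

text \<open>The rewrite turns the order's own equality into HOL equality in all inherited
  facts.\<close>

sublocale bounded_lattice E
  rewrites "eq E = (=)"
  by (fact bounded_lattice) (fact eq_is_eq)

lemma rep_bottom [simp]: "\<phi> \<bottom> = {}"
  by (metis Coz_empty bottom_closed bottom_lower le_iff rep_surj subset_empty)

lemma rep_top [simp]: "\<phi> \<top> = topspace X"
  by (metis Coz_subset_topspace Coz_topspace le_iff rep_closed rep_surj subset_antisym top_closed
      top_higher)

lemmas rep_simps = rep_join rep_meet rep_sup rep_eq_iff

text \<open>Under \<open>\<phi>\<close> the distributive laws become identities of sets, while
  normality and the approximating sequences are pulled back from \<open>Coz_normal\<close> and
  \<open>Coz_exhaustion\<close>.\<close>

lemma alexandrov_algebra: "alexandrov_algebra E"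
  unfolding alexandrov_algebra_def
proof (intro conjI allI ballI impI)
  show "distributive_lattice E"
    unfolding distributive_lattice_def using bounded_lattice by (auto simp: rep_simps)
  show "normal_lattice E"
    unfolding normal_lattice_def
  proof (intro ballI impI)
    fix a b assume ab: "a \<in> carrier E" "b \<in> carrier E" "a \<squnion> b = \<top>"
    then have "\<phi> a \<union> \<phi> b = topspace X"
      by (metis rep_join rep_top)
    then obtain C D where "C \<in> carrier (Coz X)" "D \<in> carrier (Coz X)"
      and CD: "C \<union> \<phi> a = topspace X" "\<phi> b \<union> D = topspace X" "C \<inter> D = {}"
      by (rule Coz_normal[OF rep_closed rep_closed, OF ab(1,2)])
    then obtain c d where "c \<in> carrier E" "\<phi> c = C" "d \<in> carrier E" "\<phi> d = D"
      by (metis rep_surj)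
    then show "\<exists>c\<in>carrier E. \<exists>d\<in>carrier E. c \<squnion> a = \<top> \<and> b \<squnion> d = \<top> \<and> c \<sqinter> d = \<bottom>"
      using CD ab by (intro bexI[of _ c] bexI[of _ d]) (auto simp: rep_simps)
  qed
next
  fix S assume S: "countable S \<and> S \<subseteq> carrier E"
  then show "\<exists>s. is_lub E s S"
    using ex_lub by blast
  fix a assume a: "a \<in> carrier E"
  have "(\<lambda>s. a \<sqinter> s) ` S \<subseteq> carrier E"
    using S a by auto
  then have "\<Squnion>((\<lambda>s. a \<sqinter> s) ` S) \<in> carrier E" "\<phi> (\<Squnion>((\<lambda>s. a \<sqinter> s) ` S)) = (\<Union>s\<in>S. \<phi> (a \<sqinter> s))"
    using S by (auto simp: rep_sup)
  moreover have "(\<Union>s\<in>S. \<phi> (a \<sqinter> s)) = (\<Union>s\<in>S. \<phi> a \<inter> \<phi> s)"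
    using S a by (auto simp: rep_meet subset_iff)
  ultimately show "a \<sqinter> \<Squnion>S = \<Squnion>((\<lambda>s. a \<sqinter> s) ` S)"
    using S a by (subst rep_eq_iff) (auto simp: rep_meet rep_sup)
next
  fix a assume a: "a \<in> carrier E"
  obtain B C :: "nat \<Rightarrow> 'p set" where BC: "\<And>n. B n \<in> carrier (Coz X)" "\<And>n. C n \<in> carrier (Coz X)"
    "(\<Union>n. C n) = \<phi> a" "\<And>n. B n \<inter> C n = {}" "\<And>n. B n \<union> \<phi> a = topspace X"
    using Coz_exhaustion[OF rep_closed[OF a]] by blast
  have "\<forall>n. \<exists>b. b \<in> carrier E \<and> \<phi> b = B n" "\<forall>n. \<exists>c. c \<in> carrier E \<and> \<phi> c = C n"
    using BC(1,2) by (metis rep_surj)+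
  then obtain b c where bc: "\<And>n. b n \<in> carrier E" "\<And>n. \<phi> (b n) = B n"
    "\<And>n. c n \<in> carrier E" "\<And>n. \<phi> (c n) = C n"
    by metis
  have "range c \<subseteq> carrier E"
    using bc by auto
  then have "\<Squnion>(range c) = a"
    using a BC(3) bc by (subst rep_eq_iff) (auto simp: rep_sup)
  then show "\<exists>b c :: nat \<Rightarrow> 'e. range b \<subseteq> carrier E \<and> range c \<subseteq> carrier E \<and> \<Squnion>(range c) = a \<and>
      (\<forall>n. b n \<sqinter> c n = \<bottom> \<and> b n \<squnion> a = \<top>)"
    using a BC bc by (intro exI[of _ b] exI[of _ c]) (auto simp: rep_simps)
qed

text \<open>A countable family with join \<open>\<top>\<close> is an open cover of the compact space
  \<open>X\<close>, because joins are unions.\<close>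

lemma countably_compact_algebra: "countably_compact_algebra E"
  unfolding countably_compact_algebra_def
proof (intro allI impI)
  fix c :: "nat \<Rightarrow> 'e" assume c: "range c \<subseteq> carrier E \<and> \<Squnion>(range c) = \<top>"
  then have "topspace X \<subseteq> \<Union>(\<phi> ` range c)"
    by (metis countableI_type countable_image order_refl rep_sup rep_top)
  moreover have "\<forall>V\<in>\<phi> ` range c. openin X V"
    using c openin_Coz rep_closed by blast
  ultimately obtain \<F> where "finite \<F>" "\<F> \<subseteq> \<phi> ` range c" "topspace X \<subseteq> \<Union>\<F>"
    using compact unfolding compact_space_alt by metis
  then obtain I where I: "finite I" "topspace X \<subseteq> \<Union>(\<phi> ` c ` I)"
    by (metis (no_types, lifting) finite_subset_image image_image)
  have "c ` I \<subseteq> carrier E" "countable (c ` I)"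
    using c I by (auto simp: countable_finite)
  moreover from this have "\<Union>(\<phi> ` c ` I) = topspace X"
    using I Coz_subset_topspace[OF rep_closed] by blast
  ultimately have "\<Squnion>(c ` I) = \<top>"
    by (subst rep_eq_iff) (auto simp: rep_sup)
  then show "\<exists>I. finite I \<and> \<Squnion>(c ` I) = \<top>"
    using I by blast
qed

end

text \<open>Preimage along a function commutes with intersections and unions, so a map that acts as
  a preimage on represented sets preserves all operations. Isomorphisms take \<open>h\<close> to be
  the identity of a common space.\<close>

lemma alexandrov_homI:
  assumes "cozero_representation X D \<phi>" "cozero_representation Y E \<psi>"
    and f: "f \<in> carrier D \<rightarrow> carrier E" and h: "h \<in> topspace Y \<rightarrow> topspace X"
    and rep: "\<And>a. a \<in> carrier D \<Longrightarrow> \<psi> (f a) = h -` \<phi> a \<inter> topspace Y"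
  shows "alexandrov_hom D E f"
proof -
  interpret D: cozero_representation X D \<phi> by fact
  interpret E: cozero_representation Y E \<psi> by fact
  have [simp]: "f a \<in> carrier E" if "a \<in> carrier D" for a
    using f that by auto
  have "f (\<Squnion>\<^bsub>D\<^esub>S) = \<Squnion>\<^bsub>E\<^esub>(f ` S)" if S: "countable S" "S \<subseteq> carrier D" for S
  proof -
    have fS: "f ` S \<subseteq> carrier E" "countable (f ` S)"
      using S by auto
    have "\<psi> (\<Squnion>\<^bsub>E\<^esub>(f ` S)) = (\<Union>s\<in>S. \<psi> (f s))"
      using fS by (simp add: E.rep_sup)
    also have "\<dots> = (\<Union>s\<in>S. h -` \<phi> s \<inter> topspace Y)"
      using S rep by (intro SUP_cong) auto
    finally show ?thesis
      using S fS rep by (subst E.rep_eq_iff) (auto simp: D.rep_sup)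
  qed
  moreover have "f (a \<sqinter>\<^bsub>D\<^esub> b) = f a \<sqinter>\<^bsub>E\<^esub> f b \<and> f (a \<squnion>\<^bsub>D\<^esub> b) = f a \<squnion>\<^bsub>E\<^esub> f b"
    if "a \<in> carrier D" "b \<in> carrier D" for a b
    using that rep by (auto simp: E.rep_simps D.rep_join D.rep_meet)
  moreover have "f \<bottom>\<^bsub>D\<^esub> = \<bottom>\<^bsub>E\<^esub>" "f \<top>\<^bsub>D\<^esub> = \<top>\<^bsub>E\<^esub>"
    using rep h by (auto simp: E.rep_eq_iff Pi_iff)
  ultimately show ?thesis
    using f by (auto simp: alexandrov_hom_def lattice_hom_def)
qed

lemma cozero_representation_Coz:
  assumes "compact_space X" "Hausdorff_space X"
  shows "cozero_representation X (Coz X) (\<lambda>V. V)"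
  using assms by unfold_locales (auto simp: bij_betw_def)

section \<open>Maximal ideals and countably prime filters\<close>

locale countably_compact_alexandrov =
  fixes D :: "'d gorder" (structure)
  assumes alexandrov: "alexandrov_algebra D" and countably_compact: "countably_compact_algebra D"
begin

sublocale bounded_lattice D
  using alexandrov by (simp add: alexandrov_algebra_def distributive_lattice_def)

lemma sup_is_lub:
  assumes "countable S" "S \<subseteq> carrier D"
  shows "is_lub D (\<Squnion>S) S"
  using alexandrov assms someI_ex[of "\<lambda>s. is_lub D s S"]
  by (auto simp: alexandrov_algebra_def sup_def)

lemma sup_closed [simp]: "countable S \<Longrightarrow> S \<subseteq> carrier D \<Longrightarrow> \<Squnion>S \<in> carrier D"
  using sup_is_lub least_closed by metis

lemma sup_upper: "countable S \<Longrightarrow> S \<subseteq> carrier D \<Longrightarrow> a \<in> S \<Longrightarrow> a \<sqsubseteq> \<Squnion>S"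
  using sup_is_lub[of S] by (simp add: least_Upper_above)

lemma sup_least:
  assumes "countable S" "S \<subseteq> carrier D" "u \<in> carrier D" "\<And>a. a \<in> S \<Longrightarrow> a \<sqsubseteq> u"
  shows "\<Squnion>S \<sqsubseteq> u"
  using sup_is_lub[OF assms(1,2)] assms(3,4) by (simp add: least_def Upper_def)

text \<open>This is how the empty family in the definition of primality keeps
  \<open>\<bottom>\<close> out of every countably prime filter.\<close>

lemma sup_empty: "\<Squnion>{} = \<bottom>"
  by (rule bottom_eq) (auto intro: sup_least)

lemma meet_join_distrib:
  assumes "a \<in> carrier D" "b \<in> carrier D" "c \<in> carrier D"
  shows "a \<sqinter> (b \<squnion> c) = (a \<sqinter> b) \<squnion> (a \<sqinter> c)"
  using alexandrov assms by (simp add: alexandrov_algebra_def distributive_lattice_def)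

lemma top_le_iff: "a \<in> carrier D \<Longrightarrow> \<top> \<sqsubseteq> a \<longleftrightarrow> a = \<top>"
  by auto

lemma exhaustion:
  assumes "a \<in> carrier D"
  shows "\<exists>b c :: nat \<Rightarrow> 'd. (\<forall>n. b n \<in> carrier D) \<and> (\<forall>n. c n \<in> carrier D) \<and>
    \<Squnion>(range c) = a \<and> (\<forall>n. b n \<sqinter> c n = \<bottom>) \<and> (\<forall>n. b n \<squnion> a = \<top>)"
proof -
  have "\<exists>b c :: nat \<Rightarrow> 'd. range b \<subseteq> carrier D \<and> range c \<subseteq> carrier D \<and> \<Squnion>(range c) = a \<and>
      (\<forall>n. b n \<sqinter> c n = \<bottom> \<and> b n \<squnion> a = \<top>)"
    using alexandrov assms unfolding alexandrov_algebra_def by blast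
  then show ?thesis
    by (simp add: image_subset_iff) blast
qed

section \<open>Existence and primality of maximal ideals\<close>

lemma ideal_proper_iff: "lattice_ideal D I \<Longrightarrow> I \<noteq> carrier D \<longleftrightarrow> \<top> \<notin> I"
  unfolding lattice_ideal_def by blast

lemma maximal_idealD:
  assumes "maximal_lattice_ideal D M"
  shows "lattice_ideal D M" "M \<subseteq> carrier D" "\<bottom> \<in> M" "\<top> \<notin> M"
    "\<And>a b. a \<in> M \<Longrightarrow> b \<in> carrier D \<Longrightarrow> b \<sqsubseteq> a \<Longrightarrow> b \<in> M"
    "\<And>a b. a \<in> M \<Longrightarrow> b \<in> M \<Longrightarrow> a \<squnion> b \<in> M"
  using assms ideal_proper_iff unfolding maximal_lattice_ideal_def lattice_ideal_def by auto

text \<open>Zorn's lemma on the proper ideals above \<open>I\<close>. Properness, expressed as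
  omitting \<open>\<top>\<close>, survives unions of chains.\<close>

lemma ex_maximal_ideal:
  assumes I: "lattice_ideal D I" "\<top> \<notin> I"
  shows "\<exists>M. maximal_lattice_ideal D M \<and> I \<subseteq> M"
proof -
  define \<A> where "\<A> = {J. lattice_ideal D J \<and> I \<subseteq> J \<and> \<top> \<notin> J}"
  have "\<exists>M\<in>\<A>. \<forall>J\<in>\<A>. M \<subseteq> J \<longrightarrow> J = M"
  proof (rule subset_Zorn_nonempty)
    show "\<A> \<noteq> {}"
      using I by (auto simp: \<A>_def)
    fix \<C> assume \<C>: "\<C> \<noteq> {}" "subset.chain \<A> \<C>"
    then have mem: "lattice_ideal D J \<and> I \<subseteq> J \<and> \<top> \<notin> J" if "J \<in> \<C>" for J
      using that by (auto simp: subset.chain_def \<A>_def)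
    have "a \<squnion> b \<in> \<Union>\<C>" if JK: "J \<in> \<C>" "K \<in> \<C>" "a \<in> J" "b \<in> K" for J K a b
    proof -
      have "J \<subseteq> K \<or> K \<subseteq> J"
        using \<C>(2) JK by (auto simp: subset.chain_def)
      then obtain L where "L \<in> \<C>" "a \<in> L" "b \<in> L"
        using JK by blast
      then show ?thesis
        using mem[of L] unfolding lattice_ideal_def by blast
    qed
    moreover have ideal: "J \<subseteq> carrier D" "\<bottom> \<in> J"
      "\<And>a b. a \<in> J \<Longrightarrow> b \<in> carrier D \<Longrightarrow> b \<sqsubseteq> a \<Longrightarrow> b \<in> J" if "J \<in> \<C>" for J
      using mem[OF that] unfolding lattice_ideal_def by blast+
    ultimately have "lattice_ideal D (\<Union>\<C>)"
      unfolding lattice_ideal_def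
    proof (intro conjI ballI impI)
      show "\<Union>\<C> \<subseteq> carrier D"
        using ideal(1) by blast
      show "\<bottom> \<in> \<Union>\<C>"
        using ideal(2) \<C>(1) by blast
      show "b \<in> \<Union>\<C>" if "a \<in> \<Union>\<C>" "b \<in> carrier D" "b \<sqsubseteq> a" for a b
        using that ideal(3) by blast
    qed blast
    then show "\<Union>\<C> \<in> \<A>"
      using mem \<C>(1) by (auto simp: \<A>_def)
  qed
  then obtain M where M: "M \<in> \<A>" "\<And>J. J \<in> \<A> \<Longrightarrow> M \<subseteq> J \<Longrightarrow> J = M"
    by blast
  then have "maximal_lattice_ideal D M"
    unfolding maximal_lattice_ideal_def \<A>_def using ideal_proper_iff by blast
  then show ?thesis
    using M(1) by (auto simp: \<A>_def)
qed

lemma principal_ideal: "a \<in> carrier D \<Longrightarrow> lattice_ideal D {x \<in> carrier D. x \<sqsubseteq> a}"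
  unfolding lattice_ideal_def by (auto intro: join_le le_trans)

text \<open>The ideal generated by \<open>M\<close> and \<open>a\<close> is strictly larger than
  \<open>M\<close>, hence contains \<open>\<top>\<close>.\<close>

lemma maximal_ideal_complement:
  assumes M: "maximal_lattice_ideal D M" and a: "a \<in> carrier D" "a \<notin> M"
  shows "\<exists>m\<in>M. m \<squnion> a = \<top>"
proof -
  note M' = maximal_idealD[OF M]
  \<comment> \<open>The ideal generated by \<open>M\<close> and \<open>a\<close>; a single
    \<open>m\<close> suffices because \<open>M\<close> is closed under joins.\<close>
  define I where "I = {x \<in> carrier D. \<exists>m\<in>M. x \<sqsubseteq> m \<squnion> a}"
  have carr: "m \<in> carrier D" if "m \<in> M" for m
    using M'(2) that by blast
  have "lattice_ideal D I"
    unfolding lattice_ideal_def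
  proof (intro conjI ballI impI)
    show "\<bottom> \<in> I"
      using M'(3) a by (auto simp: I_def intro!: bexI[of _ \<bottom>])
    show "y \<in> I" if "x \<in> I" "y \<in> carrier D" "y \<sqsubseteq> x" for x y
      using that a carr by (auto simp: I_def) (meson join_closed le_trans)
    fix x y assume "x \<in> I" "y \<in> I"
    then obtain m n where mn: "x \<in> carrier D" "y \<in> carrier D" "m \<in> M" "n \<in> M"
      "x \<sqsubseteq> m \<squnion> a" "y \<sqsubseteq> n \<squnion> a"
      by (auto simp: I_def)
    have c: "m \<in> carrier D" "n \<in> carrier D"
      using carr mn by auto
    have "m \<squnion> a \<sqsubseteq> (m \<squnion> n) \<squnion> a" "n \<squnion> a \<sqsubseteq> (m \<squnion> n) \<squnion> a"
      using a c by (meson join_closed join_le join_left join_right le_trans)+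
    then have "x \<sqsubseteq> (m \<squnion> n) \<squnion> a" "y \<sqsubseteq> (m \<squnion> n) \<squnion> a"
      using mn c a by (meson join_closed le_trans)+
    then show "x \<squnion> y \<in> I"
      using mn c a M'(6) by (auto simp: I_def intro!: join_le bexI[of _ "m \<squnion> n"])
  qed (auto simp: I_def)
  moreover have "M \<subseteq> I"
    unfolding I_def using carr a join_left by blast
  moreover have "a \<in> I"
    unfolding I_def using M'(3) a join_right by blast
  ultimately have "I = carrier D"
    using M a unfolding maximal_lattice_ideal_def by blast
  then have "\<top> \<in> I"
    by simp
  then obtain m where "m \<in> M" "\<top> \<sqsubseteq> m \<squnion> a"
    by (auto simp: I_def)
  then show ?thesis
    using carr a top_le_iff by auto
qed

text \<open>With \<open>m \<in> M\<close> and \<open>m \<squnion> b = \<top>\<close>, distributivity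
  writes \<open>a\<close> as the join of \<open>a \<sqinter> m\<close> and
  \<open>a \<sqinter> b\<close>. If the latter were in \<open>M\<close>, so would \<open>a\<close>
  be.\<close>

lemma maximal_ideal_prime:
  assumes M: "maximal_lattice_ideal D M" and "a \<in> carrier D" "b \<in> carrier D" "a \<notin> M" "b \<notin> M"
  shows "a \<sqinter> b \<notin> M"
proof
  assume ab: "a \<sqinter> b \<in> M"
  obtain m where m: "m \<in> M" "m \<squnion> b = \<top>"
    using maximal_ideal_complement[OF M assms(3,5)] by blast
  have mc: "m \<in> carrier D"
    using maximal_idealD(2)[OF M] m by blast
  have "a = a \<sqinter> (m \<squnion> b)"
    using assms(2) le_iff_join[of a \<top>] by (simp add: m)
  also have "\<dots> = (a \<sqinter> m) \<squnion> (a \<sqinter> b)"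
    using assms mc by (intro meet_join_distrib) auto
  also have "\<dots> \<in> M"
    using m mc ab assms(2) maximal_idealD(5,6)[OF M] by (meson meet_closed meet_right)
  finally show False
    using assms(4) by contradiction
qed

lemma maximal_ideal_finite_bound:
  assumes "maximal_lattice_ideal D M" "finite A" "A \<subseteq> M"
  shows "\<exists>u\<in>M. \<forall>a\<in>A. a \<sqsubseteq> u"
  using assms(2,3)
proof (induction A)
  case empty
  then show ?case
    using maximal_idealD(3)[OF assms(1)] by auto
next
  case (insert x A)
  then obtain u where u: "u \<in> M" "\<And>a. a \<in> A \<Longrightarrow> a \<sqsubseteq> u"
    by auto
  have c: "y \<in> carrier D" if "y \<in> M" for y
    using that maximal_idealD(2)[OF assms(1)] by blast
  have "x \<squnion> u \<in> M"
    using maximal_idealD(6)[OF assms(1)] insert.prems u by auto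
  moreover have "\<forall>a\<in>insert x A. a \<sqsubseteq> x \<squnion> u"
    using insert.prems u c by (auto intro: join_left) (meson join_closed join_right le_trans subsetD)
  ultimately show ?case
    by blast
qed

text \<open>If \<open>S\<close> lay inside \<open>M\<close>, adjoining one element of
  \<open>M\<close> would give a countable subset of \<open>M\<close> with join
  \<open>\<top>\<close>. Countable compactness leaves a finite subset with join
  \<open>\<top>\<close>, which has an upper bound in the proper ideal \<open>M\<close>.\<close>

lemma maximal_ideal_countably_prime:
  assumes M: "maximal_lattice_ideal D M" and S: "countable S" "S \<subseteq> carrier D" "\<Squnion>S \<notin> M"
  shows "\<exists>s\<in>S. s \<notin> M"
proof (rule ccontr)
  assume "\<not> (\<exists>s\<in>S. s \<notin> M)"
  then have SM: "S \<subseteq> M"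
    by blast
  obtain m where m: "m \<in> M" "m \<squnion> \<Squnion>S = \<top>"
    using maximal_ideal_complement[OF M sup_closed[OF S(1,2)] S(3)] by blast
  define T where "T = insert m S"
  have T: "T \<subseteq> M" "T \<subseteq> carrier D" "countable T" "T \<noteq> {}" "m \<in> carrier D"
    using m SM S maximal_idealD(2)[OF M] by (auto simp: T_def)
  have "m \<squnion> \<Squnion>S \<sqsubseteq> \<Squnion>T"
    using S T by (intro join_le sup_upper sup_least) (auto simp: T_def intro: sup_upper)
  then have "\<Squnion>T = \<top>"
    using T m top_le_iff by simp
  \<comment> \<open>Countable compactness speaks of sequences, so \<open>T\<close> is enumerated; it
    is nonempty because it contains \<open>m\<close>.\<close>
  moreover have range: "range (from_nat_into T) = T"
    using T by (simp add: range_from_nat_into)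
  ultimately obtain I where I: "finite I" "\<Squnion>(from_nat_into T ` I) = \<top>"
    using countably_compact T(2) unfolding countably_compact_algebra_def by metis
  define A where "A = from_nat_into T ` I"
  have A: "finite A" "A \<subseteq> M" "A \<subseteq> carrier D" "\<Squnion>A = \<top>"
    using I T from_nat_into[OF T(4)] unfolding A_def by blast+
  then obtain u where u: "u \<in> M" "\<And>a. a \<in> A \<Longrightarrow> a \<sqsubseteq> u"
    using maximal_ideal_finite_bound[OF M A(1,2)] by blast
  moreover have uc: "u \<in> carrier D"
    using u maximal_idealD(2)[OF M] by blast
  ultimately have "\<top> \<sqsubseteq> u"
    using sup_least[of A u] A by (simp add: countable_finite)
  then show False
    using u uc top_le_iff maximal_idealD(4)[OF M] by simp
qed

section \<open>Complementation between maximal ideals and countably prime filters\<close>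

lemma countably_prime_filter_complement:
  assumes M: "maximal_lattice_ideal D M"
  shows "countably_prime_filter D (carrier D - M)"
  unfolding countably_prime_filter_def lattice_filter_def
proof (intro conjI allI ballI impI)
  show "\<top> \<in> carrier D - M"
    using maximal_idealD(4)[OF M] by auto
  show "b \<in> carrier D - M" if "a \<in> carrier D - M" "b \<in> carrier D" "a \<sqsubseteq> b" for a b
    using that maximal_idealD(5)[OF M] by blast
  show "a \<sqinter> b \<in> carrier D - M" if "a \<in> carrier D - M" "b \<in> carrier D - M" for a b
    using that maximal_ideal_prime[OF M] by auto
  show "\<exists>s\<in>S. s \<in> carrier D - M"
    if "countable S \<and> S \<subseteq> carrier D \<and> \<Squnion>S \<in> carrier D - M" for S
    using that maximal_ideal_countably_prime[OF M, of S] by auto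
qed auto

lemma countably_prime_filterD:
  assumes "countably_prime_filter D F"
  shows "F \<subseteq> carrier D" "\<top> \<in> F" "\<bottom> \<notin> F"
    "\<And>a b. a \<in> F \<Longrightarrow> b \<in> carrier D \<Longrightarrow> a \<sqsubseteq> b \<Longrightarrow> b \<in> F"
    "\<And>a b. a \<in> carrier D \<Longrightarrow> b \<in> carrier D \<Longrightarrow> a \<sqinter> b \<in> F \<longleftrightarrow> a \<in> F \<and> b \<in> F"
    "\<And>S. countable S \<Longrightarrow> S \<subseteq> carrier D \<Longrightarrow> \<Squnion>S \<in> F \<longleftrightarrow> (\<exists>s\<in>S. s \<in> F)"
    "\<And>a b. a \<in> carrier D \<Longrightarrow> b \<in> carrier D \<Longrightarrow> a \<squnion> b \<in> F \<longleftrightarrow> a \<in> F \<or> b \<in> F"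
proof -
  have F: "lattice_filter D F" and prime: "\<And>S. countable S \<Longrightarrow> S \<subseteq> carrier D \<Longrightarrow> \<Squnion>S \<in> F \<Longrightarrow> \<exists>s\<in>S. s \<in> F"
    using assms by (auto simp: countably_prime_filter_def)
  show "F \<subseteq> carrier D" "\<top> \<in> F"
    using F by (auto simp: lattice_filter_def)
  show "\<bottom> \<notin> F"
    using prime[of "{}"] sup_empty by auto
  show up: "b \<in> F" if "a \<in> F" "b \<in> carrier D" "a \<sqsubseteq> b" for a b
    using F that by (auto simp: lattice_filter_def)
  show "a \<sqinter> b \<in> F \<longleftrightarrow> a \<in> F \<and> b \<in> F" if "a \<in> carrier D" "b \<in> carrier D" for a b
    using F that up[OF _ that(1)] up[OF _ that(2)] meet_left[OF that] meet_right[OF that]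
    unfolding lattice_filter_def by blast
  show sup: "\<Squnion>S \<in> F \<longleftrightarrow> (\<exists>s\<in>S. s \<in> F)" if "countable S" "S \<subseteq> carrier D" for S
    using prime[OF that] up[OF _ sup_closed[OF that]] sup_upper[OF that] by blast
  show "a \<squnion> b \<in> F \<longleftrightarrow> a \<in> F \<or> b \<in> F" if "a \<in> carrier D" "b \<in> carrier D" for a b
    using sup[of "{a, b}"] that by (simp add: join_def)
qed

text \<open>Let a larger proper ideal \<open>I\<close> contain some \<open>a \<in> F\<close>, with
  sequences \<open>b\<close>, \<open>c\<close> for \<open>a\<close>. Primality puts some
  \<open>c n\<close> in \<open>F\<close>; disjointness keeps \<open>b n\<close> out of
  \<open>F\<close> and so puts it in \<open>I\<close>. Then \<open>b n \<squnion> a = \<top>\<close>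
  lies in \<open>I\<close>.\<close>

lemma maximal_ideal_complement_filter:
  assumes F: "countably_prime_filter D F"
  shows "maximal_lattice_ideal D (carrier D - F)"
proof -
  note F' = countably_prime_filterD[OF F]
  have "lattice_ideal D (carrier D - F)"
    unfolding lattice_ideal_def using F'(3,4,7) by auto
  moreover have "I = carrier D - F"
    if I: "lattice_ideal D I" "carrier D - F \<subseteq> I" "I \<noteq> carrier D" for I
  proof (rule ccontr)
    assume "I \<noteq> carrier D - F"
    moreover have "I \<subseteq> carrier D"
      using I(1) by (simp add: lattice_ideal_def)
    ultimately obtain a where a: "a \<in> I" "a \<in> F" "a \<in> carrier D"
      using I(2) by blast
    obtain b c :: "nat \<Rightarrow> 'd" where bc: "\<And>n. b n \<in> carrier D" "\<And>n. c n \<in> carrier D"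
      "\<Squnion>(range c) = a" "\<And>n. b n \<sqinter> c n = \<bottom>" "\<And>n. b n \<squnion> a = \<top>"
      using exhaustion[OF a(3)] by blast
    obtain n where n: "c n \<in> F"
      using F'(6)[of "range c"] bc(2,3) a(2) by auto
    then have "b n \<notin> F"
      using F'(3,5) bc by metis
    then have "b n \<in> I"
      using I(2) bc by auto
    then have "\<top> \<in> I"
      using a(1) I(1) bc(5) unfolding lattice_ideal_def by metis
    then show False
      using I ideal_proper_iff by blast
  qed
  moreover have "carrier D - F \<noteq> carrier D"
    using F'(2) by auto
  ultimately show ?thesis
    unfolding maximal_lattice_ideal_def by blast
qed

text \<open>Some term \<open>c n\<close> of the sequence with join \<open>a\<close> is not below
  \<open>b\<close>, and the matching \<open>b' n\<close> is the witness: if it joined with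
  \<open>b\<close> to \<open>\<top>\<close>, distributivity and
  \<open>b' n \<sqinter> c n = \<bottom>\<close> would force \<open>c n\<close> below
  \<open>b\<close>.\<close>

lemma conjunctive_witness:
  assumes "a \<in> carrier D" "b \<in> carrier D" "\<not> a \<sqsubseteq> b"
  shows "\<exists>c\<in>carrier D. a \<squnion> c = \<top> \<and> b \<squnion> c \<noteq> \<top>"
proof -
  obtain b' c :: "nat \<Rightarrow> 'd" where bc: "\<And>n. b' n \<in> carrier D" "\<And>n. c n \<in> carrier D"
    "\<Squnion>(range c) = a" "\<And>n. b' n \<sqinter> c n = \<bottom>" "\<And>n. b' n \<squnion> a = \<top>"
    using exhaustion[OF assms(1)] by blast
  obtain n where n: "\<not> c n \<sqsubseteq> b"
    using sup_least[of "range c" b] bc assms by auto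
  have "b \<squnion> b' n \<noteq> \<top>"
  proof
    assume *: "b \<squnion> b' n = \<top>"
    have "c n = c n \<sqinter> (b \<squnion> b' n)"
      using bc le_iff_join[of "c n" \<top>] by (simp add: *)
    also have "\<dots> = (c n \<sqinter> b) \<squnion> (c n \<sqinter> b' n)"
      using bc assms by (intro meet_join_distrib) auto
    also have "\<dots> \<sqsubseteq> b"
      using bc assms meet_right meet_comm[of D "c n" "b' n"] by (auto intro!: join_le)
    finally show False
      using n by contradiction
  qed
  then show ?thesis
    using bc join_comm[of D "b' n" a] by (metis)
qed

lemma conjunctive_lattice: "conjunctive_lattice D"
  unfolding conjunctive_lattice_def using conjunctive_witness by blast

text \<open>Enough points: \<open>b \<squnion> c\<close> lies in a maximal ideal, which must omit
  \<open>a\<close> since \<open>a \<squnion> c = \<top>\<close>. Its complement is the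
  filter.\<close>

lemma filter_separation:
  assumes "a \<in> carrier D" "b \<in> carrier D" "\<not> a \<sqsubseteq> b"
  shows "\<exists>F. countably_prime_filter D F \<and> a \<in> F \<and> b \<notin> F"
proof -
  obtain c where c: "c \<in> carrier D" "a \<squnion> c = \<top>" "b \<squnion> c \<noteq> \<top>"
    using conjunctive_witness[OF assms] by blast
  obtain M where M: "maximal_lattice_ideal D M" "{x \<in> carrier D. x \<sqsubseteq> b \<squnion> c} \<subseteq> M"
    using ex_maximal_ideal[OF principal_ideal[of "b \<squnion> c"]] c assms top_le_iff[of "b \<squnion> c"] by auto
  have "b \<in> M" "c \<in> M"
    using M(2) c assms join_left join_right by auto
  then have "a \<notin> M"
    using maximal_idealD(4,6)[OF M(1)] c(2) by metis
  then show ?thesis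
    using countably_prime_filter_complement[OF M(1)] \<open>b \<in> M\<close> assms by blast
qed

end

section \<open>The space of countably prime filters\<close>

context countably_compact_alexandrov
begin

text \<open>These generators of the topology of \<open>filter_space D\<close> become the map
  \<open>\<phi>\<close> that represents \<open>D\<close> by cozero sets.\<close>

definition points :: "'d \<Rightarrow> 'd set set" where
  "points d = {F. countably_prime_filter D F \<and> d \<in> F}"

lemma topspace_filter_space: "topspace (filter_space D) = {F. countably_prime_filter D F}"
  using countably_prime_filterD(2) unfolding filter_space_def by auto

lemma points_top: "points \<top> = topspace (filter_space D)"
  using countably_prime_filterD(2) by (auto simp: points_def topspace_filter_space)

lemma points_bottom: "points \<bottom> = {}"
  using countably_prime_filterD(3) by (auto simp: points_def)

lemma points_meet: "a \<in> carrier D \<Longrightarrow> b \<in> carrier D \<Longrightarrow> points (a \<sqinter> b) = points a \<inter> points b"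
  using countably_prime_filterD(5) by (auto simp: points_def)

lemma points_join: "a \<in> carrier D \<Longrightarrow> b \<in> carrier D \<Longrightarrow> points (a \<squnion> b) = points a \<union> points b"
  using countably_prime_filterD(7) by (auto simp: points_def)

lemma points_sup: "countable S \<Longrightarrow> S \<subseteq> carrier D \<Longrightarrow> points (\<Squnion>S) = \<Union>(points ` S)"
  using countably_prime_filterD(6) by (auto simp: points_def)

lemma points_subset_iff:
  assumes "a \<in> carrier D" "b \<in> carrier D"
  shows "points a \<subseteq> points b \<longleftrightarrow> a \<sqsubseteq> b"
proof
  show "a \<sqsubseteq> b" if "points a \<subseteq> points b"
    using filter_separation[OF assms] that by (auto simp: points_def)
  show "points a \<subseteq> points b" if "a \<sqsubseteq> b"
    using countably_prime_filterD(4) that assms by (auto simp: points_def)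
qed

lemma points_subset_topspace: "points d \<subseteq> topspace (filter_space D)"
  by (auto simp: points_def topspace_filter_space)

lemma openin_points: "d \<in> carrier D \<Longrightarrow> openin (filter_space D) (points d)"
  unfolding filter_space_def points_def by (rule topology_generated_by_Basis) blast

text \<open>The generators form a base and not merely a subbase, because \<open>points\<close> turns
  meets into intersections.\<close>

lemma points_base:
  assumes "openin (filter_space D) W" "F \<in> W"
  shows "\<exists>d\<in>carrier D. F \<in> points d \<and> points d \<subseteq> W"
proof -
  have "generate_topology_on {{F. countably_prime_filter D F \<and> d \<in> F} | d. d \<in> carrier D} W"
    using assms(1) unfolding filter_space_def by (rule openin_topology_generated_by)
  then have "\<forall>F\<in>W. \<exists>d\<in>carrier D. F \<in> points d \<and> points d \<subseteq> W"
  proof induction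
    case (Int V W)
    show ?case
    proof
      fix F assume F: "F \<in> V \<inter> W"
      obtain a where a: "a \<in> carrier D" "F \<in> points a" "points a \<subseteq> V"
        using Int.IH(1) F by blast
      obtain b where b: "b \<in> carrier D" "F \<in> points b" "points b \<subseteq> W"
        using Int.IH(2) F by blast
      show "\<exists>d\<in>carrier D. F \<in> points d \<and> points d \<subseteq> V \<inter> W"
        using a b points_meet[OF a(1) b(1)] by (intro bexI[of _ "a \<sqinter> b"]) auto
    qed
  next
    case (UN K)
    show ?case
    proof
      fix F assume "F \<in> \<Union>K"
      then obtain V where V: "V \<in> K" "F \<in> V"
        by blast
      then show "\<exists>d\<in>carrier D. F \<in> points d \<and> points d \<subseteq> \<Union>K"
        using UN.IH[OF V(1)] by blast
    qed
  next
    case (Basis W)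
    then show ?case
      by (auto simp: points_def)
  qed simp
  then show ?thesis
    using assms(2) by blast
qed

text \<open>The elements whose basic open set is finitely covered form an ideal. Were it proper, a
  maximal ideal above it would yield a point, and a basic neighbourhood of this point inside one
  member of the cover would belong to the ideal.\<close>

lemma compact_filter_space: "compact_space (filter_space D)"
  unfolding compact_space_alt
proof (intro allI impI, elim conjE)
  fix \<U> assume \<U>: "\<forall>W\<in>\<U>. openin (filter_space D) W" "topspace (filter_space D) \<subseteq> \<Union>\<U>"
  define I where "I = {d \<in> carrier D. \<exists>\<F>. finite \<F> \<and> \<F> \<subseteq> \<U> \<and> points d \<subseteq> \<Union>\<F>}"
  have I: "d \<in> I" if "d \<in> carrier D" "finite \<F>" "\<F> \<subseteq> \<U>" "points d \<subseteq> \<Union>\<F>" for d \<F>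
    using that by (auto simp: I_def)
  have "lattice_ideal D I"
    unfolding lattice_ideal_def
  proof (intro conjI ballI impI)
    show "I \<subseteq> carrier D"
      by (auto simp: I_def)
    show "\<bottom> \<in> I"
      using I[of \<bottom> "{}"] points_bottom by simp
    show "b \<in> I" if a: "a \<in> I" and b: "b \<in> carrier D" "b \<sqsubseteq> a" for a b
    proof -
      obtain \<F> where \<F>: "a \<in> carrier D" "finite \<F>" "\<F> \<subseteq> \<U>" "points a \<subseteq> \<Union>\<F>"
        using a by (auto simp: I_def)
      then show ?thesis
        using I[OF b(1) \<F>(2,3)] points_subset_iff[OF b(1) \<F>(1)] b(2) by blast
    qed
    fix a b assume "a \<in> I" "b \<in> I"
    then obtain \<F> \<G> where "a \<in> carrier D" "finite \<F>" "\<F> \<subseteq> \<U>" "points a \<subseteq> \<Union>\<F>"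
      "b \<in> carrier D" "finite \<G>" "\<G> \<subseteq> \<U>" "points b \<subseteq> \<Union>\<G>"
      by (auto simp: I_def)
    then show "a \<squnion> b \<in> I"
      using points_join[of a b] by (intro I[of _ "\<F> \<union> \<G>"]) auto
  qed
  have "\<top> \<in> I"
  proof (rule ccontr)
    assume "\<top> \<notin> I"
    then obtain M where M: "maximal_lattice_ideal D M" "I \<subseteq> M"
      using ex_maximal_ideal \<open>lattice_ideal D I\<close> by blast
    have F: "carrier D - M \<in> topspace (filter_space D)"
      using countably_prime_filter_complement[OF M(1)] by (simp add: topspace_filter_space)
    then obtain W where W: "W \<in> \<U>" "carrier D - M \<in> W"
      using \<U>(2) by blast
    then obtain d where d: "d \<in> carrier D" "carrier D - M \<in> points d" "points d \<subseteq> W"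
      using points_base \<U>(1) by blast
    have "d \<in> I"
      using I[of d "{W}"] d W by simp
    then show False
      using M(2) d(2) by (auto simp: points_def)
  qed
  then show "\<exists>\<F>. finite \<F> \<and> \<F> \<subseteq> \<U> \<and> topspace (filter_space D) \<subseteq> \<Union>\<F>"
    unfolding I_def by (simp add: points_top)
qed

lemma Hausdorff_filter_space: "Hausdorff_space (filter_space D)"
  unfolding Hausdorff_space_def
proof (intro allI impI)
  fix F G assume *: "F \<in> topspace (filter_space D) \<and> G \<in> topspace (filter_space D) \<and> F \<noteq> G"
  then have F: "countably_prime_filter D F" and G: "countably_prime_filter D G"
    by (auto simp: topspace_filter_space)
  have maxF: "maximal_lattice_ideal D (carrier D - F)" and maxG: "maximal_lattice_ideal D (carrier D - G)"
    using maximal_ideal_complement_filter F G by auto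
  note F' = countably_prime_filterD[OF F] and G' = countably_prime_filterD[OF G]
  have "carrier D - F \<noteq> carrier D - G"
    using * F'(1) G'(1) by blast
  \<comment> \<open>Distinct maximal ideals are incomparable, so an element of \<open>F\<close>
    outside \<open>G\<close> exists.\<close>
  then have "\<not> carrier D - G \<subseteq> carrier D - F"
    using maxG maxF unfolding maximal_lattice_ideal_def by blast
  then obtain a where a: "a \<in> carrier D" "a \<in> F" "a \<notin> G"
    by blast
  then obtain m where m: "m \<in> carrier D" "m \<notin> F" "m \<squnion> a = \<top>"
    using maximal_ideal_complement[OF maxF a(1)] by blast
  have normal: "normal_lattice D"
    using alexandrov by (simp add: alexandrov_algebra_def)
  \<comment> \<open>Normality is applied to \<open>m \<squnion> a = \<top>\<close>. As
    \<open>m\<close> is not in \<open>F\<close>, primality puts \<open>c\<close> in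
    \<open>F\<close>; as \<open>a\<close> is not in \<open>G\<close>, it puts \<open>d\<close> in
    \<open>G\<close>.\<close>
  obtain c d where cd: "c \<in> carrier D" "d \<in> carrier D" "c \<squnion> m = \<top>" "a \<squnion> d = \<top>" "c \<sqinter> d = \<bottom>"
    using normal m a(1) unfolding normal_lattice_def by blast
  have "c \<in> F"
    using F'(7)[OF cd(1) m(1)] F'(2) m(2) cd(3) by simp
  moreover have "d \<in> G"
    using G'(7)[OF a(1) cd(2)] G'(2) a(3) cd(4) by simp
  moreover have "points c \<inter> points d = {}"
    using points_meet[OF cd(1,2)] cd(5) points_bottom by simp
  ultimately show "\<exists>U V. openin (filter_space D) U \<and> openin (filter_space D) V \<and> F \<in> U \<and> G \<in> V \<and> disjnt U V"
    using openin_points cd F G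
    by (intro exI[of _ "points c"] exI[of _ "points d"]) (auto simp: points_def disjnt_def)
qed

text \<open>The complement of \<open>points (b n)\<close> is a closed set lying between
  \<open>points (c n)\<close> and \<open>points a\<close>. A cozero set is squeezed between it and
  \<open>points a\<close>, and the union of these cozero sets is \<open>points a\<close>.\<close>

lemma points_in_Coz:
  assumes "a \<in> carrier D"
  shows "points a \<in> carrier (Coz (filter_space D))"
proof -
  let ?X = "filter_space D"
  obtain b c :: "nat \<Rightarrow> 'd" where bc: "\<And>n. b n \<in> carrier D" "\<And>n. c n \<in> carrier D"
    "\<Squnion>(range c) = a" "\<And>n. b n \<sqinter> c n = \<bottom>" "\<And>n. b n \<squnion> a = \<top>"
    using exhaustion[OF assms] by blast
  have "normal_space ?X"
    using compact_filter_space Hausdorff_filter_space compact_Hausdorff_or_regular_imp_normal_space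
    by blast
  moreover have "closedin ?X (topspace ?X - points (b n))" for n
    using openin_points bc(1) by blast
  moreover have "topspace ?X - points (b n) \<subseteq> points a" for n
    using points_join[OF bc(1) assms, of n] points_top bc(5) by auto
  ultimately have "\<exists>V. V \<in> carrier (Coz ?X) \<and> topspace ?X - points (b n) \<subseteq> V \<and> V \<subseteq> points a" for n
    using Coz_between[of ?X "topspace ?X - points (b n)" "points a"] openin_points[OF assms] by metis
  then obtain V where V: "\<And>n. V n \<in> carrier (Coz ?X)" "\<And>n. topspace ?X - points (b n) \<subseteq> V n"
    "\<And>n. V n \<subseteq> points a"
    by metis
  have c: "points (c n) \<subseteq> V n" for n
    using points_meet[OF bc(1,2), of n n] bc(4) points_bottom points_subset_topspace[of "c n"] V(2)[of n]
    by auto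
  have "points a = (\<Union>n. points (c n))"
    using points_sup[of "range c"] bc(2,3) by auto
  also have "\<dots> \<subseteq> (\<Union>n. V n)"
    using c by (intro UN_mono) auto
  finally have "points a = (\<Union>n. V n)"
    using UN_least[of UNIV V "points a"] V(3) by blast
  then show ?thesis
    using Coz_UN_nat[of V ?X, OF V(1)] by simp
qed

text \<open>The counterpart of \<open>Coz_between\<close> with a basic open set: finitely many basic
  open sets inside \<open>W\<close> cover the compact set \<open>K\<close>, and their join is one
  basic open set.\<close>

lemma points_between:
  assumes "closedin (filter_space D) K" "openin (filter_space D) W" "K \<subseteq> W"
  shows "\<exists>e\<in>carrier D. K \<subseteq> points e \<and> points e \<subseteq> W"
proof -
  define \<U> where "\<U> = points ` {d \<in> carrier D. points d \<subseteq> W}"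
  have "compactin (filter_space D) K"
    using compact_filter_space assms(1) by (rule closedin_compact_space)
  moreover have "\<forall>V\<in>\<U>. openin (filter_space D) V"
    using openin_points by (auto simp: \<U>_def)
  moreover have "K \<subseteq> \<Union>\<U>"
    using points_base[OF assms(2)] assms(3) unfolding \<U>_def by blast
  ultimately obtain \<F> where \<F>: "finite \<F>" "\<F> \<subseteq> \<U>" "K \<subseteq> \<Union>\<F>"
    unfolding compactin_def by blast
  then obtain A where A: "finite A" "A \<subseteq> {d \<in> carrier D. points d \<subseteq> W}" "K \<subseteq> \<Union>(points ` A)"
    using finite_subset_image[OF \<F>(1,2)[unfolded \<U>_def]] by blast
  then have "countable A" "A \<subseteq> carrier D"
    by (auto intro: countable_finite)
  then show ?thesis
    using A points_sup[of A] by (intro bexI[of _ "\<Squnion>A"]) auto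
qed

text \<open>Between each \<open>C n\<close> and \<open>V\<close> lies the closed complement of
  \<open>B n\<close>, which \<open>points_between\<close> encloses in some
  \<open>points (e n)\<close> inside \<open>V\<close>. The countable join of the \<open>e n\<close>
  represents \<open>V\<close>.\<close>

lemma Coz_is_points:
  assumes "V \<in> carrier (Coz (filter_space D))"
  shows "\<exists>d\<in>carrier D. V = points d"
proof -
  let ?X = "filter_space D"
  obtain B C :: "nat \<Rightarrow> 'd set set" where BC: "\<And>n. B n \<in> carrier (Coz ?X)"
    "\<And>n. C n \<in> carrier (Coz ?X)" "(\<Union>n. C n) = V" "\<And>n. B n \<inter> C n = {}" "\<And>n. B n \<union> V = topspace ?X"
    using Coz_exhaustion[OF assms] by blast
  have "\<exists>e. e \<in> carrier D \<and> C n \<subseteq> points e \<and> points e \<subseteq> V" for n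
  proof -
    have "closedin ?X (topspace ?X - B n)" "topspace ?X - B n \<subseteq> V"
      using openin_Coz[OF BC(1)] BC(5)[of n] by auto
    moreover have "C n \<subseteq> topspace ?X - B n"
      using BC(4)[of n] Coz_subset_topspace[OF BC(2)[of n]] by auto
    ultimately show ?thesis
      using points_between[of "topspace ?X - B n" V] openin_Coz[OF assms] by (meson order_trans)
  qed
  then obtain e where e: "\<And>n. e n \<in> carrier D" "\<And>n. C n \<subseteq> points (e n)" "\<And>n. points (e n) \<subseteq> V"
    by metis
  have "countable (range e)" "range e \<subseteq> carrier D"
    using e(1) by auto
  moreover have "V = (\<Union>n. points (e n))"
  proof
    show "V \<subseteq> (\<Union>n. points (e n))"
      unfolding BC(3)[symmetric] using e(2) by (intro UN_mono) auto
    show "(\<Union>n. points (e n)) \<subseteq> V"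
      using e(3) by (rule UN_least)
  qed
  ultimately show ?thesis
    using points_sup[of "range e"] by (intro bexI[of _ "\<Squnion>(range e)"]) auto
qed

lemma cozero_representation_points: "cozero_representation (filter_space D) D points"
proof
  show "bij_betw points (carrier D) (carrier (Coz (filter_space D)))"
    unfolding bij_betw_def
  proof
    show "inj_on points (carrier D)"
      by (intro inj_onI le_antisym) (simp_all flip: points_subset_iff)
    show "points ` carrier D = carrier (Coz (filter_space D))"
      using points_in_Coz Coz_is_points by blast
  qed
qed (simp_all add: compact_filter_space Hausdorff_filter_space eq_is_equal points_subset_iff)

end

section \<open>Homomorphisms and maximal ideal spaces\<close>

lemma (in cozero_representation) countably_compact_alexandrov: "countably_compact_alexandrov E"
  using alexandrov_algebra countably_compact_algebra by (simp add: countably_compact_alexandrov_def)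

lemma AlexAlg_c_eq:
  "AlexAlg_c = concrete_category carrier {D. countably_compact_alexandrov D} alexandrov_hom"
  by (simp add: AlexAlg_c_def AlexAlg_def full_subcategory_concrete countably_compact_alexandrov_def)

text \<open>Two notions of homomorphism need to agree only between the chosen objects, as
  \<open>alexandrov_hom\<close> and \<open>maximal_hom\<close> do.\<close>

lemma concrete_category_cong:
  assumes "\<And>X Y f. X \<in> Os \<Longrightarrow> Y \<in> Os \<Longrightarrow> H X Y f = H' X Y f"
  shows "concrete_category U Os H = concrete_category U Os H'"
  using assms unfolding concrete_category_def by (simp cong: conj_cong)

context countably_compact_alexandrov
begin

text \<open>Maps in arrows are restricted to the carrier; this transfers the laws from the
  unrestricted map.\<close>

lemma alexandrov_hom_cong:
  assumes "alexandrov_hom D E f" "\<And>a. a \<in> carrier D \<Longrightarrow> f a = g a"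
  shows "alexandrov_hom D E g"
proof -
  have "g ` S = f ` S" if "S \<subseteq> carrier D" for S
    using that assms(2) by (intro image_cong) (auto simp: subset_iff)
  then show ?thesis
    using assms unfolding alexandrov_hom_def lattice_hom_def by (simp add: Pi_iff)
qed

lemma alexandrov_hom_ident: "alexandrov_hom D D (\<lambda>a\<in>carrier D. a)"
  by (rule alexandrov_hom_cong[of D "\<lambda>a. a"]) (simp_all add: alexandrov_hom_def lattice_hom_def)

lemma alexandrov_hom_comp:
  assumes f: "alexandrov_hom D E f" and g: "alexandrov_hom E E' g"
  shows "alexandrov_hom D E' (compose (carrier D) g f)"
proof (rule alexandrov_hom_cong[of _ "\<lambda>a. g (f a)"])
  have fm: "f \<in> carrier D \<rightarrow> carrier E"
    using f by (simp add: alexandrov_hom_def lattice_hom_def)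
  have "g (f (\<Squnion>S)) = \<Squnion>\<^bsub>E'\<^esub>((\<lambda>a. g (f a)) ` S)" if "countable S" "S \<subseteq> carrier D" for S
  proof -
    have "f ` S \<subseteq> carrier E"
      using fm that by auto
    then have "g (f (\<Squnion>S)) = \<Squnion>\<^bsub>E'\<^esub>(g ` f ` S)"
      using f g that by (simp add: alexandrov_hom_def)
    then show ?thesis
      by (simp add: image_image)
  qed
  then show "alexandrov_hom D E' (\<lambda>a. g (f a))"
    using f g by (auto simp: alexandrov_hom_def lattice_hom_def Pi_iff)
qed (simp add: compose_def)

lemma alexandrov_hom_mono:
  assumes "alexandrov_hom D E f" "countably_compact_alexandrov E"
    "a \<in> carrier D" "b \<in> carrier D" "a \<sqsubseteq> b"
  shows "f a \<sqsubseteq>\<^bsub>E\<^esub> f b"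
proof -
  interpret E: countably_compact_alexandrov E by fact
  have "f a \<squnion>\<^bsub>E\<^esub> f b = f b"
  proof -
    have "f (a \<squnion> b) = f a \<squnion>\<^bsub>E\<^esub> f b"
      using assms by (simp add: alexandrov_hom_def lattice_hom_def)
    then show ?thesis
      using assms le_iff_meet[of a b] by simp
  qed
  then show ?thesis
    using assms E.le_iff_meet[of "f a" "f b"] by (auto simp: alexandrov_hom_def lattice_hom_def Pi_iff)
qed

lemma countably_prime_filter_vimage:
  assumes f: "alexandrov_hom D E f" and E: "countably_compact_alexandrov E"
    and F: "countably_prime_filter E F"
  shows "countably_prime_filter D (f -` F \<inter> carrier D)"
proof -
  interpret E: countably_compact_alexandrov E by fact
  note F' = E.countably_prime_filterD[OF F]
  have fm: "f a \<in> carrier E" if "a \<in> carrier D" for a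
    using f that by (auto simp: alexandrov_hom_def lattice_hom_def)
  have hom: "f \<top> = \<top>\<^bsub>E\<^esub>" "\<And>a b. a \<in> carrier D \<Longrightarrow> b \<in> carrier D \<Longrightarrow> f (a \<sqinter> b) = f a \<sqinter>\<^bsub>E\<^esub> f b"
    "\<And>S. countable S \<Longrightarrow> S \<subseteq> carrier D \<Longrightarrow> f (\<Squnion>S) = \<Squnion>\<^bsub>E\<^esub>(f ` S)"
    using f by (auto simp: alexandrov_hom_def lattice_hom_def)
  show ?thesis
    unfolding countably_prime_filter_def lattice_filter_def
  proof (intro conjI allI ballI impI)
    show "\<top> \<in> f -` F \<inter> carrier D"
      using F'(2) hom(1) by simp
    show "b \<in> f -` F \<inter> carrier D"
      if "a \<in> f -` F \<inter> carrier D" "b \<in> carrier D" "a \<sqsubseteq> b" for a b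
      using that F'(4)[of "f a" "f b"] fm alexandrov_hom_mono[OF f E, of a b] by auto
    show "a \<sqinter> b \<in> f -` F \<inter> carrier D"
      if "a \<in> f -` F \<inter> carrier D" "b \<in> f -` F \<inter> carrier D" for a b
      using that F'(5)[of "f a" "f b"] fm hom(2)[of a b] by auto
    show "\<exists>s\<in>S. s \<in> f -` F \<inter> carrier D"
      if S: "countable S \<and> S \<subseteq> carrier D \<and> \<Squnion>S \<in> f -` F \<inter> carrier D" for S
    proof -
      have fS: "countable (f ` S)" "f ` S \<subseteq> carrier E"
        using S fm by auto
      then have "\<exists>s\<in>f ` S. s \<in> F"
        using F'(6)[OF fS] hom(3)[of S] S by auto
      then show ?thesis
        using S by auto
    qed
  qed auto
qed

lemma continuous_map_vimage:
  assumes f: "alexandrov_hom D E f" and E: "countably_compact_alexandrov E"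
  shows "continuous_map (filter_space E) (filter_space D) (\<lambda>F. f -` F \<inter> carrier D)"
proof -
  interpret E: countably_compact_alexandrov E by fact
  have fm: "f a \<in> carrier E" if "a \<in> carrier D" for a
    using f that by (auto simp: alexandrov_hom_def lattice_hom_def)
  have topD: "\<Union>{{F. countably_prime_filter D F \<and> d \<in> F} | d. d \<in> carrier D} = {F. countably_prime_filter D F}"
    using topspace_filter_space by (simp add: filter_space_def)
  show ?thesis
    unfolding filter_space_def[of D]
  proof (rule continuous_on_generated_topo)
    show "(\<lambda>F. f -` F \<inter> carrier D) ` topspace (filter_space E) \<subseteq>
        \<Union>{{F. countably_prime_filter D F \<and> d \<in> F} | d. d \<in> carrier D}"
      unfolding topD using countably_prime_filter_vimage[OF f E] by (auto simp: E.topspace_filter_space)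
    fix U assume "U \<in> {{F. countably_prime_filter D F \<and> d \<in> F} | d. d \<in> carrier D}"
    then obtain d where d: "d \<in> carrier D" "U = {F. countably_prime_filter D F \<and> d \<in> F}"
      by blast
    \<comment> \<open>The preimage of the basic open set of \<open>d\<close> is that of
      \<open>f d\<close>, which gives continuity.\<close>
    have "(\<lambda>F. f -` F \<inter> carrier D) -` U \<inter> topspace (filter_space E) = E.points (f d)"
      using d countably_prime_filter_vimage[OF f E]
      by (auto simp: E.topspace_filter_space E.points_def)
    then show "openin (filter_space E) ((\<lambda>F. f -` F \<inter> carrier D) -` U \<inter> topspace (filter_space E))"
      using E.openin_points fm d by simp
  qed
qed

section \<open>The maximal ideal space and maximal homomorphisms\<close>

lemma topspace_max_space: "topspace (max_space D) = {M. maximal_lattice_ideal D M}"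
  using maximal_idealD(4) unfolding max_space_def by auto

lemma complement_complement: "F \<subseteq> carrier D \<Longrightarrow> carrier D - (carrier D - F) = F"
  by blast

text \<open>Complementation exchanges the conditions \<open>d \<in> F\<close> and
  \<open>d \<notin> M\<close>, hence the generators of the two topologies.\<close>

lemma homeomorphic_maps_complement:
  "homeomorphic_maps (max_space D) (filter_space D) (\<lambda>M. carrier D - M) (\<lambda>F. carrier D - F)"
  unfolding homeomorphic_maps_def
proof (intro conjI ballI)
  have topD: "\<Union>{{F. countably_prime_filter D F \<and> d \<in> F} | d. d \<in> carrier D} = {F. countably_prime_filter D F}"
    using topspace_filter_space by (simp add: filter_space_def)
  have topM: "\<Union>{{M. maximal_lattice_ideal D M \<and> d \<notin> M} | d. d \<in> carrier D} = {M. maximal_lattice_ideal D M}"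
    using topspace_max_space by (simp add: max_space_def)
  show "continuous_map (max_space D) (filter_space D) (\<lambda>M. carrier D - M)"
    unfolding filter_space_def
  proof (rule continuous_on_generated_topo)
    show "(\<lambda>M. carrier D - M) ` topspace (max_space D) \<subseteq>
        \<Union>{{F. countably_prime_filter D F \<and> d \<in> F} | d. d \<in> carrier D}"
      unfolding topD using countably_prime_filter_complement by (auto simp: topspace_max_space)
    fix U assume "U \<in> {{F. countably_prime_filter D F \<and> d \<in> F} | d. d \<in> carrier D}"
    then obtain d where d: "d \<in> carrier D" "U = {F. countably_prime_filter D F \<and> d \<in> F}"
      by blast
    have "(\<lambda>M. carrier D - M) -` U \<inter> topspace (max_space D) = {M. maximal_lattice_ideal D M \<and> d \<notin> M}"
      using d countably_prime_filter_complement by (auto simp: topspace_max_space)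
    moreover have "openin (max_space D) {M. maximal_lattice_ideal D M \<and> d \<notin> M}"
      unfolding max_space_def using d(1) by (intro topology_generated_by_Basis) blast
    ultimately show "openin (max_space D) ((\<lambda>M. carrier D - M) -` U \<inter> topspace (max_space D))"
      by simp
  qed
  show "continuous_map (filter_space D) (max_space D) (\<lambda>F. carrier D - F)"
    unfolding max_space_def
  proof (rule continuous_on_generated_topo)
    show "(\<lambda>F. carrier D - F) ` topspace (filter_space D) \<subseteq>
        \<Union>{{M. maximal_lattice_ideal D M \<and> d \<notin> M} | d. d \<in> carrier D}"
      unfolding topM using maximal_ideal_complement_filter by (auto simp: topspace_filter_space)
    fix U assume "U \<in> {{M. maximal_lattice_ideal D M \<and> d \<notin> M} | d. d \<in> carrier D}"
    then obtain d where d: "d \<in> carrier D" "U = {M. maximal_lattice_ideal D M \<and> d \<notin> M}"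
      by blast
    have "(\<lambda>F. carrier D - F) -` U \<inter> topspace (filter_space D) = points d"
      using d maximal_ideal_complement_filter by (auto simp: topspace_filter_space points_def)
    then show "openin (filter_space D) ((\<lambda>F. carrier D - F) -` U \<inter> topspace (filter_space D))"
      using openin_points d by simp
  qed
  show "carrier D - (carrier D - M) = M" if "M \<in> topspace (max_space D)" for M
    using that maximal_idealD(2) by (intro complement_complement) (auto simp: topspace_max_space)
  show "carrier D - (carrier D - F) = F" if "F \<in> topspace (filter_space D)" for F
    using that countably_prime_filterD(1) by (intro complement_complement) (auto simp: topspace_filter_space)
qed

lemma
  shows compact_max_space: "compact_space (max_space D)"
    and Hausdorff_max_space: "Hausdorff_space (max_space D)"
proof -
  have "max_space D homeomorphic_space filter_space D"
    using homeomorphic_maps_complement homeomorphic_space_def by blast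
  then show "compact_space (max_space D)" "Hausdorff_space (max_space D)"
    using compact_filter_space Hausdorff_filter_space homeomorphic_compact_space
      homeomorphic_Hausdorff_space by blast+
qed

lemma eq_if_same_filters:
  assumes "a \<in> carrier D" "b \<in> carrier D"
    "\<And>F. countably_prime_filter D F \<Longrightarrow> a \<in> F \<longleftrightarrow> b \<in> F"
  shows "a = b"
  using filter_separation[OF assms(1,2)] filter_separation[OF assms(2,1)] assms by blast

lemma isomorphic_Coz_filter_space: "isomorphic_lattices D (Coz (filter_space D))"
proof -
  interpret cozero_representation "filter_space D" D points
    by (rule cozero_representation_points)
  have "alexandrov_hom D (Coz (filter_space D)) points"
    using points_subset_topspace
    by (intro alexandrov_homI[OF cozero_representation_points cozero_representation_Coz, where h="\<lambda>x. x"])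
      (auto simp: compact Hausdorff)
  then show ?thesis
    using bij by (auto simp: isomorphic_lattices_def alexandrov_hom_def)
qed

lemma maximal_hom_iff:
  assumes E: "countably_compact_alexandrov E"
  shows "maximal_hom D E f \<longleftrightarrow> alexandrov_hom D E f"
proof
  interpret E: countably_compact_alexandrov E by fact
  show "maximal_hom D E f" if f: "alexandrov_hom D E f"
    unfolding maximal_hom_def
  proof (intro conjI allI impI)
    show "lattice_hom D E f"
      using f by (simp add: alexandrov_hom_def)
    then have fm: "f a \<in> carrier E" if "a \<in> carrier D" for a
      using that by (auto simp: lattice_hom_def)
    fix M assume "maximal_lattice_ideal E M"
    then have "countably_prime_filter D (f -` (carrier E - M) \<inter> carrier D)"
      by (intro countably_prime_filter_vimage[OF f E] E.countably_prime_filter_complement)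
    then have "maximal_lattice_ideal D (carrier D - (f -` (carrier E - M) \<inter> carrier D))"
      by (rule maximal_ideal_complement_filter)
    moreover have "carrier D - (f -` (carrier E - M) \<inter> carrier D) = f -` M \<inter> carrier D"
      using fm by auto
    ultimately show "maximal_lattice_ideal D (f -` M \<inter> carrier D)"
      by simp
  qed
  show "alexandrov_hom D E f" if f: "maximal_hom D E f"
    unfolding alexandrov_hom_def
  proof (intro conjI allI impI)
    show hom: "lattice_hom D E f"
      using f by (simp add: maximal_hom_def)
    then have fm: "f a \<in> carrier E" if "a \<in> carrier D" for a
      using that by (auto simp: lattice_hom_def)
    fix S assume S: "countable S \<and> S \<subseteq> carrier D"
    then have fS: "countable (f ` S)" "f ` S \<subseteq> carrier E"
      using fm by auto
    show "f (\<Squnion>S) = \<Squnion>\<^bsub>E\<^esub>(f ` S)"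
    proof (rule E.eq_if_same_filters)
      fix F assume F: "countably_prime_filter E F"
      have "maximal_lattice_ideal D (f -` (carrier E - F) \<inter> carrier D)"
        using f E.maximal_ideal_complement_filter[OF F] by (simp add: maximal_hom_def)
      then have "countably_prime_filter D (carrier D - (f -` (carrier E - F) \<inter> carrier D))"
        by (rule countably_prime_filter_complement)
      then have "countably_prime_filter D (f -` F \<inter> carrier D)"
        by (rule back_subst[of "countably_prime_filter D"]) (use fm in auto)
      from countably_prime_filterD(6)[OF this, of S]
      have "f (\<Squnion>S) \<in> F \<longleftrightarrow> (\<exists>s\<in>S. f s \<in> F)"
        using S by auto
      also have "\<dots> \<longleftrightarrow> \<Squnion>\<^bsub>E\<^esub>(f ` S) \<in> F"
        using E.countably_prime_filterD(6)[OF F fS] by simp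
      finally show "f (\<Squnion>S) \<in> F \<longleftrightarrow> \<Squnion>\<^bsub>E\<^esub>(f ` S) \<in> F" .
    qed (use S fS fm in auto)
  qed
qed

end

text \<open>A lattice isomorphism reflects the order because \<open>a \<sqsubseteq> b\<close> is the
  equation \<open>a = a \<sqinter> b\<close>.\<close>

lemma cozero_representation_isomorphism:
  assumes X: "compact_space X" "Hausdorff_space X" and D: "distributive_lattice D"
    and f: "lattice_hom D (Coz X) f" "bij_betw f (carrier D) (carrier (Coz X))"
  shows "cozero_representation X D f"
proof -
  interpret D: bounded_lattice D
    using D by (simp add: distributive_lattice_def)
  interpret Coz: cozero_representation X "Coz X" "\<lambda>V. V"
    using X by (rule cozero_representation_Coz)
  have closed: "f a \<in> carrier (Coz X)" if "a \<in> carrier D" for a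
    using f(1) that by (auto simp: lattice_hom_def)
  show ?thesis
  proof
    show "a \<sqsubseteq>\<^bsub>D\<^esub> b \<longleftrightarrow> f a \<subseteq> f b" if ab: "a \<in> carrier D" "b \<in> carrier D" for a b
    proof -
      have "a \<sqsubseteq>\<^bsub>D\<^esub> b \<longleftrightarrow> a = a \<sqinter>\<^bsub>D\<^esub> b"
        using ab by (rule D.le_iff_join)
      also have "\<dots> \<longleftrightarrow> f a = f (a \<sqinter>\<^bsub>D\<^esub> b)"
        using f(2) ab by (auto simp: bij_betw_def inj_on_def)
      also have "f (a \<sqinter>\<^bsub>D\<^esub> b) = f a \<inter> f b"
        using f(1) ab Coz.rep_meet[OF closed[OF ab(1)] closed[OF ab(2)]] by (simp add: lattice_hom_def)
      finally show ?thesis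
        by blast
    qed
  qed (simp_all add: X D.eq_is_equal f(2))
qed

text \<open>From left to right the space is \<open>filter_space D\<close>, whose type is the one the
  existential quantifier ranges over; from right to left the isomorphism is a cozero
  representation.\<close>

lemma CHDLat_objects:
  fixes D :: "'d gorder"
  shows "countably_compact_alexandrov D \<longleftrightarrow> distributive_lattice D \<and> conjunctive_lattice D \<and>
    (\<exists>X :: 'd set topology. compact_space X \<and> Hausdorff_space X \<and> isomorphic_lattices D (Coz X))"
proof
  assume "countably_compact_alexandrov D"
  then interpret countably_compact_alexandrov D .
  show "distributive_lattice D \<and> conjunctive_lattice D \<and>
    (\<exists>X :: 'd set topology. compact_space X \<and> Hausdorff_space X \<and> isomorphic_lattices D (Coz X))"
    using alexandrov conjunctive_lattice compact_filter_space Hausdorff_filter_space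
      isomorphic_Coz_filter_space by (auto simp: alexandrov_algebra_def)
next
  assume "distributive_lattice D \<and> conjunctive_lattice D \<and>
    (\<exists>X :: 'd set topology. compact_space X \<and> Hausdorff_space X \<and> isomorphic_lattices D (Coz X))"
  then show "countably_compact_alexandrov D"
    using cozero_representation_isomorphism cozero_representation.countably_compact_alexandrov
    unfolding isomorphic_lattices_def by metis
qed

lemma AlexAlg_c_eq_CHDLat: "AlexAlg_c = CHDLat"
  unfolding AlexAlg_c_eq CHDLat_def CHDLat_objects[symmetric]
  by (rule concrete_category_cong) (simp add: countably_compact_alexandrov.maximal_hom_iff)

section \<open>The duality\<close>

lemma category_AlexAlg_c: "category AlexAlg_c"
  unfolding AlexAlg_c_eq
proof (rule category_concrete)
  show "f \<in> carrier D \<rightarrow> carrier E" if "alexandrov_hom D E f" for D E :: "'a gorder" and f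
    using that by (simp add: alexandrov_hom_def lattice_hom_def)
qed (auto intro: countably_compact_alexandrov.alexandrov_hom_ident
    countably_compact_alexandrov.alexandrov_hom_comp)

lemma continuous_map_restrict:
  "continuous_map X Y f \<Longrightarrow> continuous_map X Y (restrict f (topspace X))"
  by (rule continuous_map_eq) auto

lemma category_CHaus: "category CHaus"
  unfolding CHaus_def
proof (rule category_concrete)
  show "f \<in> topspace X \<rightarrow> topspace Y" if "continuous_map X Y f" for X Y :: "'a topology" and f
    using that by (rule continuous_map_funspace)
  show "continuous_map X X (\<lambda>x\<in>topspace X. x)" for X :: "'a topology"
    by (rule continuous_map_restrict) simp
  show "continuous_map X Z (compose (topspace X) g f)"
    if "continuous_map X Y f" "continuous_map Y Z g" for X Y Z :: "'a topology" and f g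
    using continuous_map_restrict[OF continuous_map_compose[OF that]] by (simp add: compose_def o_def)
qed

lemma iso_arrow_CHaus:
  assumes "compact_space X" "Hausdorff_space X" "compact_space Y" "Hausdorff_space Y"
    and fg: "homeomorphic_maps X Y f g"
  shows "iso_arrow CHaus (Arrow X (restrict f (topspace X)) Y)"
  unfolding CHaus_def
proof (rule iso_arrow_concrete[where g="restrict g (topspace Y)"])
  have f: "continuous_map X Y f" and g: "continuous_map Y X g"
    using fg by (auto simp: homeomorphic_maps_def)
  show "continuous_map X Y (restrict f (topspace X))" "continuous_map Y X (restrict g (topspace Y))"
    using f g by (auto intro: continuous_map_restrict)
  show "restrict g (topspace Y) (restrict f (topspace X) x) = x" if "x \<in> topspace X" for x
    using fg that continuous_map_funspace[OF f] by (auto simp: homeomorphic_maps_def)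
  show "restrict f (topspace X) (restrict g (topspace Y) y) = y" if "y \<in> topspace Y" for y
    using fg that continuous_map_funspace[OF g] by (auto simp: homeomorphic_maps_def)
qed (use assms in auto)

text \<open>Both algebras are represented on the same space, so the inverse is \<open>\<psi>\<close>
  followed by the inverse of \<open>\<phi>\<close>, and both maps act as preimages under the
  identity.\<close>

lemma iso_arrow_AlexAlg_c:
  assumes "cozero_representation X D \<phi>" "cozero_representation X E \<psi>"
    and f: "f \<in> extensional (carrier D)" "f \<in> carrier D \<rightarrow> carrier E"
      "\<And>a. a \<in> carrier D \<Longrightarrow> \<psi> (f a) = \<phi> a"
  shows "iso_arrow AlexAlg_c (Arrow D f E)"
proof -
  interpret D: cozero_representation X D \<phi> by fact
  interpret E: cozero_representation X E \<psi> by fact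
  define g where "g = (\<lambda>e\<in>carrier E. inv_into (carrier D) \<phi> (\<psi> e))"
  have g: "g e \<in> carrier D \<and> \<phi> (g e) = \<psi> e" if "e \<in> carrier E" for e
  proof -
    have "\<psi> e \<in> \<phi> ` carrier D"
      using E.rep_closed[OF that] D.bij by (simp add: bij_betw_def)
    then show ?thesis
      using that by (simp add: g_def inv_into_into f_inv_into_f)
  qed
  show ?thesis
    unfolding AlexAlg_c_eq
  proof (rule iso_arrow_concrete[where g=g])
    show "alexandrov_hom D E f"
      by (rule alexandrov_homI[OF assms(1,2) f(2), where h="\<lambda>x. x"])
        (use f(3) Coz_subset_topspace[OF D.rep_closed] in auto)
    show "alexandrov_hom E D g"
      by (rule alexandrov_homI[OF assms(2,1), where h="\<lambda>x. x"])
        (use g Coz_subset_topspace[OF E.rep_closed] in auto)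
    show "g (f a) = a" if "a \<in> carrier D" for a
      using that f g[of "f a"] D.rep_eq_iff[of "g (f a)" a] by (simp add: Pi_iff)
    show "f (g e) = e" if "e \<in> carrier E" for e
      using that f g[of e] E.rep_eq_iff[of "f (g e)" e] by (simp add: Pi_iff)
  qed (use f D.countably_compact_alexandrov E.countably_compact_alexandrov in \<open>auto simp: g_def\<close>)
qed

lemma is_functor_Coz: "is_functor (opposite CHaus) AlexAlg_c Coz_functor"
proof -
  have cca: "countably_compact_alexandrov (Coz X)" if "compact_space X" "Hausdorff_space X" for X :: "'a topology"
    using cozero_representation_Coz[OF that] by (rule cozero_representation.countably_compact_alexandrov)
  have hom: "alexandrov_hom (Coz Y) (Coz X) (\<lambda>V\<in>carrier (Coz Y). f -` V \<inter> topspace X)"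
    if "compact_space X" "Hausdorff_space X" "compact_space Y" "Hausdorff_space Y" "continuous_map X Y f"
    for X Y :: "'a topology" and f
    using that by (intro alexandrov_homI[OF cozero_representation_Coz cozero_representation_Coz, where h=f])
      (auto intro: Coz_vimage dest: continuous_map_funspace)
  have "(\<lambda>V\<in>carrier (Coz X). (\<lambda>x\<in>topspace X. x) -` V \<inter> topspace X) = (\<lambda>V\<in>carrier (Coz X). V)"
    for X :: "'a topology"
    using Coz_subset_topspace by (fastforce simp: fun_eq_iff)
  moreover have "(\<lambda>V\<in>carrier (Coz Z). compose (topspace X) g f -` V \<inter> topspace X) =
      compose (carrier (Coz Z)) (\<lambda>V\<in>carrier (Coz Y). f -` V \<inter> topspace X)
        (\<lambda>V\<in>carrier (Coz Z). g -` V \<inter> topspace Y)"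
    if f: "continuous_map X Y f" and g: "continuous_map Y Z g" for X Y Z :: "'a topology" and f g
  proof -
    have "compose (topspace X) g f -` V \<inter> topspace X = f -` (g -` V \<inter> topspace Y) \<inter> topspace X" for V
      using continuous_map_funspace[OF f] by (auto simp: compose_def)
    then show ?thesis
      using Coz_vimage[OF g] by (auto simp: fun_eq_iff compose_def)
  qed
  ultimately show ?thesis
    unfolding is_functor_def
    using category_opposite[OF category_CHaus] category_AlexAlg_c
    by (auto simp: CHaus_def AlexAlg_c_eq Coz_functor_def cca hom)
qed

lemma is_functor_C: "is_functor AlexAlg_c (opposite CHaus) C_functor"
  unfolding C_functor_def AlexAlg_c_eq CHaus_def
proof (rule is_functor_preimage)
  show "category (concrete_category carrier {D. countably_compact_alexandrov D} alexandrov_hom)"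
    using category_AlexAlg_c by (simp add: AlexAlg_c_eq)
  show "category (concrete_category topspace {X. compact_space X \<and> Hausdorff_space X} continuous_map)"
    using category_CHaus by (simp add: CHaus_def)
  fix D :: "'a gorder" assume "D \<in> {D. countably_compact_alexandrov D}"
  then interpret countably_compact_alexandrov D by simp
  show "filter_space D \<in> {X. compact_space X \<and> Hausdorff_space X}"
    by (simp add: compact_filter_space Hausdorff_filter_space)
  show "F \<subseteq> carrier D" if "F \<in> topspace (filter_space D)" for F
    using that countably_prime_filterD(1) by (auto simp: topspace_filter_space)
  fix E :: "'a gorder" and f assume *: "E \<in> {D. countably_compact_alexandrov D}" "alexandrov_hom D E f"
  then show "continuous_map (filter_space E) (filter_space D) (\<lambda>F. f -` F \<inter> carrier D)"
    by (simp add: continuous_map_vimage)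
  show "f \<in> carrier D \<rightarrow> carrier E"
    using * by (simp add: alexandrov_hom_def lattice_hom_def)
qed

lemma is_functor_Max: "is_functor AlexAlg_c (opposite CHaus) Max_functor"
  unfolding Max_functor_def AlexAlg_c_eq CHaus_def
proof (rule is_functor_preimage)
  show "category (concrete_category carrier {D. countably_compact_alexandrov D} alexandrov_hom)"
    using category_AlexAlg_c by (simp add: AlexAlg_c_eq)
  show "category (concrete_category topspace {X. compact_space X \<and> Hausdorff_space X} continuous_map)"
    using category_CHaus by (simp add: CHaus_def)
  fix D :: "'a gorder" assume "D \<in> {D. countably_compact_alexandrov D}"
  then interpret D: countably_compact_alexandrov D by simp
  show "max_space D \<in> {X. compact_space X \<and> Hausdorff_space X}"
    by (simp add: D.compact_max_space D.Hausdorff_max_space)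
  show "M \<subseteq> carrier D" if "M \<in> topspace (max_space D)" for M
    using that D.maximal_idealD(2) by (auto simp: D.topspace_max_space)
  fix E :: "'a gorder" and f assume *: "E \<in> {D. countably_compact_alexandrov D}" "alexandrov_hom D E f"
  then interpret E: countably_compact_alexandrov E by simp
  show f: "f \<in> carrier D \<rightarrow> carrier E"
    using * by (simp add: alexandrov_hom_def lattice_hom_def)
  \<comment> \<open>Continuity is transported from the filter spaces by complementing before and
    after; the two complements cancel since \<open>f\<close> maps into
    \<open>carrier E\<close>.\<close>
  have "continuous_map (max_space E) (max_space D)
      ((\<lambda>F. carrier D - F) \<circ> ((\<lambda>F. f -` F \<inter> carrier D) \<circ> (\<lambda>M. carrier E - M)))"
    using D.homeomorphic_maps_complement E.homeomorphic_maps_complement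
      D.continuous_map_vimage[OF *(2) E.countably_compact_alexandrov_axioms]
    by (intro continuous_map_compose) (auto simp: homeomorphic_maps_def)
  then show "continuous_map (max_space E) (max_space D) (\<lambda>M. f -` M \<inter> carrier D)"
    by (rule continuous_map_eq) (use f in auto)
qed

section \<open>Renaming spaces and algebras along \<open>raise\<close>\<close>

lemma topspace_raise_space: "topspace (raise_space X) = raise ` topspace X"
  by (rule homeomorphic_imp_surjective_map[OF homeomorphic_map_raise, symmetric])

lemma homeomorphic_maps_raise: "homeomorphic_maps X (raise_space X) raise lower"
proof -
  obtain g where g: "homeomorphic_maps X (raise_space X) raise g"
    using homeomorphic_map_raise homeomorphic_map_maps by blast
  then have "g z = lower z" if "z \<in> topspace (raise_space X)" for z
    using that by (auto simp: homeomorphic_maps_def topspace_raise_space)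
  then show ?thesis
    using g by (auto simp: homeomorphic_maps_def intro: continuous_map_eq)
qed

lemma
  assumes "compact_space X" "Hausdorff_space X"
  shows compact_raise_space: "compact_space (raise_space X)"
    and Hausdorff_raise_space: "Hausdorff_space (raise_space X)"
proof -
  have "X homeomorphic_space raise_space X"
    using homeomorphic_maps_raise homeomorphic_space_def by blast
  then show "compact_space (raise_space X)" "Hausdorff_space (raise_space X)"
    using assms homeomorphic_compact_space homeomorphic_Hausdorff_space by blast+
qed

lemma is_functor_Raise_CHaus: "is_functor CHaus CHaus Raise_CHaus"
  unfolding Raise_CHaus_def CHaus_def
proof (rule is_functor_raise)
  show "category (concrete_category topspace {X. compact_space X \<and> Hausdorff_space X} continuous_map)"
    "category (concrete_category topspace {X. compact_space X \<and> Hausdorff_space X} continuous_map)"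
    using category_CHaus by (simp_all add: CHaus_def)
  show "f \<in> topspace X \<rightarrow> topspace Y" if "continuous_map X Y f" for X Y :: "'a topology" and f
    using that by (rule continuous_map_funspace)
  show "continuous_map (raise_space X) (raise_space Y) (\<lambda>z\<in>raise ` topspace X. raise (f (lower z)))"
    if f: "continuous_map X Y f" for X Y :: "'a topology" and f
  proof -
    have "continuous_map (raise_space X) (raise_space Y) (raise \<circ> (f \<circ> lower))"
      using homeomorphic_maps_raise[of X] homeomorphic_maps_raise[of Y] f
      by (intro continuous_map_compose) (auto simp: homeomorphic_maps_def)
    from continuous_map_restrict[OF this] show ?thesis
      by (simp add: topspace_raise_space o_def)
  qed
qed (auto simp: compact_raise_space Hausdorff_raise_space topspace_raise_space)

lemma carrier_raise_lattice: "carrier (raise_lattice D) = raise ` carrier D"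
  by (simp add: raise_lattice_def)

lemma cozero_representation_raise:
  assumes "cozero_representation X D \<phi>"
  shows "cozero_representation X (raise_lattice D) (\<lambda>z. \<phi> (lower z))"
proof -
  interpret cozero_representation X D \<phi> by fact
  show ?thesis
  proof
    show "bij_betw (\<lambda>z. \<phi> (lower z)) (carrier (raise_lattice D)) (carrier (Coz X))"
      using bij by (auto simp: bij_betw_def inj_on_def carrier_raise_lattice image_image)
    show "z \<sqsubseteq>\<^bsub>raise_lattice D\<^esub> w \<longleftrightarrow> \<phi> (lower z) \<subseteq> \<phi> (lower w)"
      if "z \<in> carrier (raise_lattice D)" "w \<in> carrier (raise_lattice D)" for z w
      using that le_iff by (auto simp: carrier_raise_lattice le_raise_lattice)
  qed (simp_all add: compact Hausdorff raise_lattice_def)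
qed

lemma (in countably_compact_alexandrov) cozero_representation_raise_points:
  "cozero_representation (filter_space D) (raise_lattice D) (\<lambda>z. points (lower z))"
  using cozero_representation_points by (rule cozero_representation_raise)

lemma is_functor_Raise_AlexAlg: "is_functor AlexAlg_c AlexAlg_c Raise_AlexAlg"
  unfolding Raise_AlexAlg_def AlexAlg_c_eq
proof (rule is_functor_raise)
  show "category (concrete_category carrier {D. countably_compact_alexandrov D} alexandrov_hom)"
    "category (concrete_category carrier {D. countably_compact_alexandrov D} alexandrov_hom)"
    using category_AlexAlg_c by (simp_all add: AlexAlg_c_eq)
  show "f \<in> carrier D \<rightarrow> carrier E" if "alexandrov_hom D E f" for D E :: "'a gorder" and f
    using that by (simp add: alexandrov_hom_def lattice_hom_def)
  show "carrier (raise_lattice D) = raise ` carrier D" for D :: "'a gorder"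
    by (rule carrier_raise_lattice)
  fix D :: "'a gorder" assume "D \<in> {D. countably_compact_alexandrov D}"
  then interpret D: countably_compact_alexandrov D by simp
  show "raise_lattice D \<in> {D. countably_compact_alexandrov D}"
    using D.cozero_representation_raise_points cozero_representation.countably_compact_alexandrov
    by blast
  fix E :: "'a gorder" and f assume *: "E \<in> {D. countably_compact_alexandrov D}" "alexandrov_hom D E f"
  then interpret E: countably_compact_alexandrov E by simp
  have f: "f \<in> carrier D \<rightarrow> carrier E"
    using * by (simp add: alexandrov_hom_def lattice_hom_def)
  show "alexandrov_hom (raise_lattice D) (raise_lattice E) (\<lambda>z\<in>raise ` carrier D. raise (f (lower z)))"
  proof (rule alexandrov_homI[OF D.cozero_representation_raise_points E.cozero_representation_raise_points,
        where h="\<lambda>F. f -` F \<inter> carrier D"])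
    show "(\<lambda>z\<in>raise ` carrier D. raise (f (lower z))) \<in> carrier (raise_lattice D) \<rightarrow> carrier (raise_lattice E)"
      using f by (auto simp: carrier_raise_lattice)
    show "(\<lambda>F. f -` F \<inter> carrier D) \<in> topspace (filter_space E) \<rightarrow> topspace (filter_space D)"
      using D.continuous_map_vimage[OF *(2) E.countably_compact_alexandrov_axioms]
      by (rule continuous_map_funspace)
    fix z assume "z \<in> carrier (raise_lattice D)"
    then show "E.points (lower ((\<lambda>z\<in>raise ` carrier D. raise (f (lower z))) z)) =
        (\<lambda>F. f -` F \<inter> carrier D) -` D.points (lower z) \<inter> topspace (filter_space E)"
      using D.countably_prime_filter_vimage[OF *(2) E.countably_compact_alexandrov_axioms]
      by (auto simp: carrier_raise_lattice E.points_def D.points_def E.topspace_filter_space)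
  qed
qed

section \<open>A compact Hausdorff space as the space of filters of its cozero sets\<close>

definition point_filter :: "'a topology \<Rightarrow> 'a \<Rightarrow> 'a set set" where
  "point_filter X x = {V \<in> carrier (Coz X). x \<in> V}"

lemma topspace_filter_space_Coz:
  assumes X: "compact_space X" "Hausdorff_space X"
  shows "topspace (filter_space (Coz X)) = point_filter X ` topspace X"
proof -
  interpret R: cozero_representation X "Coz X" "\<lambda>V. V"
    using X by (rule cozero_representation_Coz)
  interpret countably_compact_alexandrov "Coz X"
    by (rule R.countably_compact_alexandrov)
  have "countably_prime_filter (Coz X) (point_filter X x)" if "x \<in> topspace X" for x
    unfolding countably_prime_filter_def lattice_filter_def
  proof (intro conjI allI ballI impI)
    show "\<top>\<^bsub>Coz X\<^esub> \<in> point_filter X x"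
      using that R.rep_top R.top_closed by (simp add: point_filter_def)
    show "W \<in> point_filter X x"
      if "V \<in> point_filter X x" "W \<in> carrier (Coz X)" "V \<sqsubseteq>\<^bsub>Coz X\<^esub> W" for V W
      using that by (auto simp: point_filter_def)
    show "V \<sqinter>\<^bsub>Coz X\<^esub> W \<in> point_filter X x" if "V \<in> point_filter X x" "W \<in> point_filter X x" for V W
      using that R.rep_meet[of V W] R.meet_closed[of V W] by (simp add: point_filter_def)
    show "\<exists>V\<in>S. V \<in> point_filter X x"
      if S: "countable S \<and> S \<subseteq> carrier (Coz X) \<and> \<Squnion>\<^bsub>Coz X\<^esub>S \<in> point_filter X x" for S
      using S R.rep_sup[of S] by (auto simp: point_filter_def)
  qed (auto simp: point_filter_def)
  moreover have "\<exists>x\<in>topspace X. F = point_filter X x" if F: "countably_prime_filter (Coz X) F" for F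
  proof -
    note F' = countably_prime_filterD[OF F]
    \<comment> \<open>Otherwise the cozero sets outside \<open>F\<close> cover \<open>X\<close>. A
      finite subcover has join \<open>\<top>\<close>, which lies in \<open>F\<close>, so primality
      puts one of its members in \<open>F\<close>.\<close>
    have "\<exists>x\<in>topspace X. point_filter X x \<subseteq> F"
    proof (rule ccontr)
      assume "\<not> (\<exists>x\<in>topspace X. point_filter X x \<subseteq> F)"
      then have *: "\<exists>V\<in>carrier (Coz X) - F. x \<in> V" if "x \<in> topspace X" for x
        using that unfolding point_filter_def by blast
      have "topspace X \<subseteq> \<Union>(carrier (Coz X) - F)" "\<forall>V\<in>carrier (Coz X) - F. openin X V"
        using * openin_Coz by blast+
      then obtain \<F> where \<F>: "finite \<F>" "\<F> \<subseteq> carrier (Coz X) - F" "topspace X \<subseteq> \<Union>\<F>"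
        using X(1) unfolding compact_space_alt by meson
      then have c: "countable \<F>" "\<F> \<subseteq> carrier (Coz X)"
        by (auto intro: countable_finite)
      have "\<Union>\<F> = topspace X"
        using \<F>(3) c(2) Coz_subset_topspace by blast
      then have "\<Squnion>\<^bsub>Coz X\<^esub>\<F> = \<top>\<^bsub>Coz X\<^esub>"
        using R.rep_sup[OF c] R.rep_top by simp
      then show False
        using F'(6)[OF c] F'(2) \<F>(2) by auto
    qed
    then obtain x where x: "x \<in> topspace X" "point_filter X x \<subseteq> F"
      by blast
    \<comment> \<open>If \<open>x\<close> is not in \<open>V\<close>, exhaust \<open>V\<close>: some
      \<open>C n\<close> is in \<open>F\<close> by primality, while \<open>B n\<close> contains
      \<open>x\<close> and so is in \<open>F\<close> as well, although the two are disjoint.\<close>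
    have "V \<in> point_filter X x" if VF: "V \<in> F" for V
    proof (rule ccontr)
      assume "V \<notin> point_filter X x"
      have V: "V \<in> carrier (Coz X)"
        using VF F'(1) by blast
      then have "x \<notin> V"
        using \<open>V \<notin> point_filter X x\<close> by (simp add: point_filter_def)
      obtain B C :: "nat \<Rightarrow> 'a set" where BC: "\<And>n. B n \<in> carrier (Coz X)"
        "\<And>n. C n \<in> carrier (Coz X)" "(\<Union>n. C n) = V" "\<And>n. B n \<inter> C n = {}" "\<And>n. B n \<union> V = topspace X"
        using Coz_exhaustion[OF V] by blast
      have c: "countable (range C)" "range C \<subseteq> carrier (Coz X)"
        using BC(2) by auto
      have "\<Squnion>\<^bsub>Coz X\<^esub>(range C) = V"
        using R.rep_sup[OF c] BC(3) by simp
      then obtain n where n: "C n \<in> F"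
        using F'(6)[OF c] VF by auto
      have "x \<in> B n"
        using BC(5)[of n] x(1) \<open>x \<notin> V\<close> by blast
      then have "B n \<in> F"
        using x(2) BC(1) by (auto simp: point_filter_def)
      then have "B n \<sqinter>\<^bsub>Coz X\<^esub> C n \<in> F"
        using n F'(5)[OF BC(1,2)] by blast
      then show False
        using R.rep_meet[OF BC(1,2)] BC(4) R.rep_bottom F'(3) by simp
    qed
    then show ?thesis
      using x by blast
  qed
  ultimately show ?thesis
    unfolding topspace_filter_space by blast
qed

text \<open>A continuous bijection from a compact space to a Hausdorff space. It is injective
  because cozero sets form a base, and continuous because the basic open set of \<open>V\<close>
  pulls back to \<open>V\<close>.\<close>

lemma homeomorphic_map_point_filter:
  assumes X: "compact_space X" "Hausdorff_space X"
  shows "homeomorphic_map X (filter_space (Coz X)) (point_filter X)"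
proof (rule continuous_imp_homeomorphic_map)
  interpret R: cozero_representation X "Coz X" "\<lambda>V. V"
    using X by (rule cozero_representation_Coz)
  interpret countably_compact_alexandrov "Coz X"
    by (rule R.countably_compact_alexandrov)
  note top = topspace_filter_space_Coz[OF X]
  show "point_filter X ` topspace X = topspace (filter_space (Coz X))"
    by (simp add: top)
  show "Hausdorff_space (filter_space (Coz X))"
    by (rule Hausdorff_filter_space)
  show "inj_on (point_filter X) (topspace X)"
  proof (rule inj_onI, rule ccontr)
    fix x y assume xy: "x \<in> topspace X" "y \<in> topspace X" "point_filter X x = point_filter X y" "x \<noteq> y"
    then obtain U where "openin X U" "x \<in> U" "y \<notin> U"
      using X(2) unfolding Hausdorff_space_def disjnt_def by (metis disjoint_iff)
    then obtain V where "V \<in> carrier (Coz X)" "x \<in> V" "y \<notin> V"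
      using Coz_base[OF X, of U x] by blast
    then show False
      using xy(3) by (auto simp: point_filter_def)
  qed
  show "continuous_map X (filter_space (Coz X)) (point_filter X)"
    unfolding filter_space_def
  proof (rule continuous_on_generated_topo)
    show "point_filter X ` topspace X \<subseteq>
        \<Union>{{F. countably_prime_filter (Coz X) F \<and> d \<in> F} | d. d \<in> carrier (Coz X)}"
      using top unfolding filter_space_def by simp
    fix U assume "U \<in> {{F. countably_prime_filter (Coz X) F \<and> d \<in> F} | d. d \<in> carrier (Coz X)}"
    then obtain V where V: "V \<in> carrier (Coz X)" "U = {F. countably_prime_filter (Coz X) F \<and> V \<in> F}"
      by blast
    have "countably_prime_filter (Coz X) (point_filter X x)" if "x \<in> topspace X" for x
      using that top topspace_filter_space by blast
    then have "point_filter X -` U \<inter> topspace X = V"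
      using V Coz_subset_topspace by (auto simp: point_filter_def)
    then show "openin X (point_filter X -` U \<inter> topspace X)"
      using openin_Coz[OF V(1)] by simp
  qed
qed (rule X)

section \<open>The natural isomorphisms of the duality\<close>

lemma compose_raise_cong:
  assumes "\<And>x. x \<in> A \<Longrightarrow> g (k (raise x)) = g' (k' (raise x))"
  shows "compose (raise ` A) g k = compose (raise ` A) g' k'"
  using assms by (auto simp: compose_def fun_eq_iff)

lemma naturally_isomorphic_Raise_CHaus:
  "naturally_isomorphic (opposite (CHaus :: 'a space_cat)) (opposite (CHaus :: 'a set set space_cat))
     Raise_CHaus (functor_comp C_functor Coz_functor)"
proof -
  let ?\<eta> = "\<lambda>X :: 'a topology. Arrow (raise_space X)
    (restrict (point_filter X \<circ> lower) (topspace (raise_space X))) (filter_space (Coz X))"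
  have cca: "countably_compact_alexandrov (Coz X)" if "compact_space X" "Hausdorff_space X" for X :: "'a topology"
    using cozero_representation_Coz[OF that] by (rule cozero_representation.countably_compact_alexandrov)
  have "natural_iso CHaus CHaus Raise_CHaus (functor_comp C_functor Coz_functor) ?\<eta>"
    unfolding natural_iso_def
  proof (intro conjI ballI)
    show "is_functor CHaus CHaus Raise_CHaus"
      by (rule is_functor_Raise_CHaus)
    show "is_functor CHaus CHaus (functor_comp C_functor Coz_functor)"
      using is_functor_opposite[OF is_functor_comp[OF is_functor_Coz is_functor_C]] by simp
    fix X :: "'a topology" assume "X \<in> Obj CHaus"
    then have X: "compact_space X" "Hausdorff_space X"
      by (auto simp: CHaus_def)
    interpret countably_compact_alexandrov "Coz X"
      using X by (rule cca)
    obtain g where g: "homeomorphic_maps X (filter_space (Coz X)) (point_filter X) g"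
      using homeomorphic_map_point_filter[OF X] homeomorphic_map_maps by blast
    have "homeomorphic_maps (raise_space X) X lower raise"
      using homeomorphic_maps_raise homeomorphic_maps_sym by blast
    from homeomorphic_maps_compose[OF conjI[OF this g]] show "iso_arrow CHaus (?\<eta> X)"
      by (rule iso_arrow_CHaus[OF compact_raise_space Hausdorff_raise_space compact_filter_space
            Hausdorff_filter_space, OF X X])
    show "Dom CHaus (?\<eta> X) = fobj Raise_CHaus X"
      "Cod CHaus (?\<eta> X) = fobj (functor_comp C_functor Coz_functor) X"
      by (simp_all add: CHaus_def Raise_CHaus_def raise_functor_def functor_comp_def C_functor_def
          preimage_functor_def Coz_functor_def)
  next
    fix a :: "('a topology, 'a) arrow" assume "a \<in> Arr CHaus"
    then obtain X Y f where a: "a = Arrow X f Y" and X: "compact_space X" "Hausdorff_space X"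
      and Y: "compact_space Y" "Hausdorff_space Y" and f: "continuous_map X Y f"
      by (auto simp: CHaus_def)
    define h where "h = (\<lambda>V\<in>carrier (Coz Y). f -` V \<inter> topspace X)"
    have G: "farr (functor_comp C_functor Coz_functor) a = Arrow (filter_space (Coz X))
        (\<lambda>P\<in>topspace (filter_space (Coz X)). h -` P \<inter> carrier (Coz Y)) (filter_space (Coz Y))"
      by (simp add: a functor_comp_def C_functor_def preimage_functor_def Coz_functor_def h_def)
    have F: "farr Raise_CHaus a =
        Arrow (raise_space X) (\<lambda>z\<in>raise ` topspace X. raise (f (lower z))) (raise_space Y)"
      by (simp add: a Raise_CHaus_def raise_functor_def)
    have "point_filter X x \<in> topspace (filter_space (Coz X))" if "x \<in> topspace X" for x
      using that topspace_filter_space_Coz[OF X] by blast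
    moreover have "h -` point_filter X x \<inter> carrier (Coz Y) = point_filter Y (f x)"
      if "x \<in> topspace X" for x
      using that Coz_vimage[OF f] by (auto simp: point_filter_def h_def)
    moreover have "f x \<in> topspace Y" if "x \<in> topspace X" for x
      using that continuous_map_funspace[OF f] by auto
    ultimately have "compose (raise ` topspace X)
        (\<lambda>P\<in>topspace (filter_space (Coz X)). h -` P \<inter> carrier (Coz Y))
        (restrict (point_filter X \<circ> lower) (raise ` topspace X)) =
      compose (raise ` topspace X) (restrict (point_filter Y \<circ> lower) (raise ` topspace Y))
        (\<lambda>z\<in>raise ` topspace X. raise (f (lower z)))"
      \<comment> \<open>Each point of the renamed space has the form \<open>raise x\<close>, so the
        square only asserts that pulling back the filter of \<open>x\<close> gives the filter of
        \<open>f x\<close>.\<close>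
      by (intro compose_raise_cong) simp
    then show "Cmp CHaus (farr (functor_comp C_functor Coz_functor) a) (?\<eta> (Dom CHaus a)) =
        Cmp CHaus (?\<eta> (Cod CHaus a)) (farr Raise_CHaus a)"
      unfolding F G by (simp add: a CHaus_def topspace_raise_space)
  qed
  \<comment> \<open>The components run from the renamed space to the filter space in
    \<open>CHaus\<close>. Dualizing reverses them, and symmetry restores the order of the
    functors.\<close>
  then have "naturally_isomorphic (opposite CHaus) (opposite CHaus)
      (functor_comp C_functor Coz_functor) (Raise_CHaus :: ('a topology, _, _, _) functor_data)"
    unfolding naturally_isomorphic_def using natural_iso_opposite by blast
  then show ?thesis
    by (rule naturally_isomorphic_sym)
qed

lemma naturally_isomorphic_Raise_AlexAlg:
  "naturally_isomorphic (AlexAlg_c :: 'd lattice_cat) (AlexAlg_c :: 'd set set lattice_cat)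
     Raise_AlexAlg (functor_comp Coz_functor C_functor)"
proof -
  let ?\<eta> = "\<lambda>D :: 'd gorder. Arrow (raise_lattice D)
    (\<lambda>z\<in>raise ` carrier D. countably_compact_alexandrov.points D (lower z)) (Coz (filter_space D))"
  have "natural_iso AlexAlg_c AlexAlg_c Raise_AlexAlg (functor_comp Coz_functor C_functor) ?\<eta>"
    unfolding natural_iso_def
  proof (intro conjI ballI)
    show "is_functor AlexAlg_c AlexAlg_c Raise_AlexAlg"
      by (rule is_functor_Raise_AlexAlg)
    show "is_functor AlexAlg_c AlexAlg_c (functor_comp Coz_functor C_functor)"
      by (rule is_functor_comp[OF is_functor_C is_functor_Coz])
    fix D :: "'d gorder" assume "D \<in> Obj AlexAlg_c"
    then interpret countably_compact_alexandrov D
      by (simp add: AlexAlg_c_eq)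
    show "iso_arrow AlexAlg_c (?\<eta> D)"
      \<comment> \<open>Both algebras are represented on \<open>filter_space D\<close>, the renamed
        one by \<open>points\<close> after \<open>lower\<close> and the other by the
        identity.\<close>
      by (rule iso_arrow_AlexAlg_c[OF cozero_representation_raise_points cozero_representation_Coz])
        (auto simp: compact_filter_space Hausdorff_filter_space carrier_raise_lattice points_in_Coz)
    show "Dom AlexAlg_c (?\<eta> D) = fobj Raise_AlexAlg D"
      "Cod AlexAlg_c (?\<eta> D) = fobj (functor_comp Coz_functor C_functor) D"
      by (simp_all add: AlexAlg_c_eq Raise_AlexAlg_def raise_functor_def functor_comp_def C_functor_def
          preimage_functor_def Coz_functor_def)
  next
    fix a :: "('d gorder, 'd) arrow" assume "a \<in> Arr AlexAlg_c"
    then obtain D E f where a: "a = Arrow D f E" and D: "countably_compact_alexandrov D"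
      and E: "countably_compact_alexandrov E" and f: "alexandrov_hom D E f"
      by (auto simp: AlexAlg_c_eq)
    interpret D: countably_compact_alexandrov D by fact
    interpret E: countably_compact_alexandrov E by fact
    define h where "h = (\<lambda>F\<in>topspace (filter_space E). f -` F \<inter> carrier D)"
    have G: "farr (functor_comp Coz_functor C_functor) a = Arrow (Coz (filter_space D))
        (\<lambda>V\<in>carrier (Coz (filter_space D)). h -` V \<inter> topspace (filter_space E)) (Coz (filter_space E))"
      by (simp add: a functor_comp_def C_functor_def preimage_functor_def Coz_functor_def h_def)
    have F: "farr Raise_AlexAlg a =
        Arrow (raise_lattice D) (\<lambda>z\<in>raise ` carrier D. raise (f (lower z))) (raise_lattice E)"
      by (simp add: a Raise_AlexAlg_def raise_functor_def)
    have "f d \<in> carrier E" if "d \<in> carrier D" for d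
      using that f by (auto simp: alexandrov_hom_def lattice_hom_def)
    moreover have "h -` D.points d \<inter> topspace (filter_space E) = E.points (f d)" if "d \<in> carrier D" for d
      using that D.countably_prime_filter_vimage[OF f E]
      by (auto simp: h_def D.points_def E.points_def E.topspace_filter_space)
    ultimately have "compose (raise ` carrier D)
        (\<lambda>V\<in>carrier (Coz (filter_space D)). h -` V \<inter> topspace (filter_space E))
        (\<lambda>z\<in>raise ` carrier D. D.points (lower z)) =
      compose (raise ` carrier D) (\<lambda>z\<in>raise ` carrier E. E.points (lower z))
        (\<lambda>z\<in>raise ` carrier D. raise (f (lower z)))"
      using D.points_in_Coz by (intro compose_raise_cong) simp
    then show "Cmp AlexAlg_c (farr (functor_comp Coz_functor C_functor) a) (?\<eta> (Dom AlexAlg_c a)) =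
        Cmp AlexAlg_c (?\<eta> (Cod AlexAlg_c a)) (farr Raise_AlexAlg a)"
      unfolding F G by (simp add: a AlexAlg_c_eq carrier_raise_lattice)
  qed
  then show ?thesis
    by (auto simp: naturally_isomorphic_def)
qed

lemma naturally_isomorphic_C_Max:
  "naturally_isomorphic AlexAlg_c (opposite CHaus) C_functor Max_functor"
proof -
  \<comment> \<open>The component goes from \<open>max_space D\<close> to
    \<open>filter_space D\<close> in \<open>CHaus\<close>, hence from \<open>C\<close> to
    \<open>Max\<close> in the opposite category.\<close>
  let ?\<eta> = "\<lambda>D :: 'd gorder. Arrow (max_space D)
    (restrict (\<lambda>M. carrier D - M) (topspace (max_space D))) (filter_space D)"
  have "natural_iso AlexAlg_c (opposite CHaus) C_functor Max_functor ?\<eta>"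
    unfolding natural_iso_def
  proof (intro conjI ballI is_functor_C is_functor_Max)
    fix D :: "'d gorder" assume "D \<in> Obj AlexAlg_c"
    then interpret countably_compact_alexandrov D
      by (simp add: AlexAlg_c_eq)
    show "iso_arrow (opposite CHaus) (?\<eta> D)"
      by (intro iso_arrow_opposite iso_arrow_CHaus[OF _ _ _ _ homeomorphic_maps_complement]
          compact_max_space Hausdorff_max_space compact_filter_space Hausdorff_filter_space)
    show "Dom (opposite CHaus) (?\<eta> D) = fobj C_functor D"
      "Cod (opposite CHaus) (?\<eta> D) = fobj Max_functor D"
      by (simp_all add: CHaus_def C_functor_def Max_functor_def preimage_functor_def)
  next
    fix a :: "('d gorder, 'd) arrow" assume "a \<in> Arr AlexAlg_c"
    then obtain D E f where a: "a = Arrow D f E" and D: "countably_compact_alexandrov D"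
      and E: "countably_compact_alexandrov E" and f: "alexandrov_hom D E f"
      by (auto simp: AlexAlg_c_eq)
    interpret D: countably_compact_alexandrov D by fact
    interpret E: countably_compact_alexandrov E by fact
    have fm: "f d \<in> carrier E" if "d \<in> carrier D" for d
      using that f by (auto simp: alexandrov_hom_def lattice_hom_def)
    have "maximal_hom D E f"
      using f D.maximal_hom_iff[OF E] by simp
    then have "f -` M \<inter> carrier D \<in> topspace (max_space D)" if "M \<in> topspace (max_space E)" for M
      using that by (simp add: D.topspace_max_space E.topspace_max_space maximal_hom_def)
    moreover have "carrier E - M \<in> topspace (filter_space E)" if "M \<in> topspace (max_space E)" for M
      using that E.countably_prime_filter_complement
      by (simp add: E.topspace_max_space E.topspace_filter_space)
    moreover have "f -` (carrier E - M) \<inter> carrier D = carrier D - (f -` M \<inter> carrier D)" for M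
      using fm by auto
    ultimately show "Cmp (opposite CHaus) (farr Max_functor a) (?\<eta> (Dom AlexAlg_c a)) =
        Cmp (opposite CHaus) (?\<eta> (Cod AlexAlg_c a)) (farr C_functor a)"
      by (auto simp: a AlexAlg_c_eq CHaus_def C_functor_def Max_functor_def preimage_functor_def
          compose_def fun_eq_iff)
  qed
  then show ?thesis
    by (auto simp: naturally_isomorphic_def)
qed

theorem theorem3p5:
  shows
    "is_functor (opposite (CHaus :: 'a space_cat)) (AlexAlg_c :: 'a set lattice_cat) Coz_functor \<and>
     is_functor (AlexAlg_c :: 'd lattice_cat) (opposite (CHaus :: 'd set space_cat)) C_functor \<and>
     naturally_isomorphic (opposite (CHaus :: 'a space_cat)) (opposite (CHaus :: 'a set set space_cat))
       Raise_CHaus (functor_comp C_functor Coz_functor) \<and>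
     naturally_isomorphic (AlexAlg_c :: 'd lattice_cat) (AlexAlg_c :: 'd set set lattice_cat)
       Raise_AlexAlg (functor_comp Coz_functor C_functor) \<and>
     (AlexAlg_c :: 'd lattice_cat) = CHDLat \<and>
     is_functor (CHDLat :: 'd lattice_cat) (opposite (CHaus :: 'd set space_cat)) Max_functor \<and>
     naturally_isomorphic (AlexAlg_c :: 'd lattice_cat) (opposite (CHaus :: 'd set space_cat))
       C_functor Max_functor"
  \<comment> \<open>Replacing \<open>CHDLat\<close> by \<open>AlexAlg_c\<close> turns the equality
    of categories into reflexivity and makes \<open>Max\<close> a functor on
    \<open>AlexAlg_c\<close>.\<close>
  unfolding AlexAlg_c_eq_CHDLat[symmetric]
  by (intro conjI refl is_functor_Coz is_functor_C is_functor_Max naturally_isomorphic_Raise_CHaus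
      naturally_isomorphic_Raise_AlexAlg naturally_isomorphic_C_Max)

end
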